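(* Let $p$ be an odd prime and let $G=U_3(p)$ be the extraspecial $p$-group of order $p^3$ and exponent $p$. Then in $\hat Y(G)$: (1) All components are isomorphic as cell complexes and there are $\frac{(p^2-1)(p^2-p)}{2}$ of them. (2) The cell structure of each component of $\hat Y(G)$ is a regular abstract $3$-polytope with Schläfli symbol $\{2p,p\}$. (3) These cell structures hence tessellate the closed oriented surface of genus $g=\frac{p(p-3)}{2}+1$ with $2p$-gons. The face, edge and vertex counts of this regular tesselation are $F=p$, $E=p^2$, $V=2p$, and the vertex valency is $p$.
   Context: $U_3(p)$ is the group of $3\times3$ upper triangular matrices over $\mathbb F_p$ with $1$'s on the diagonal. For a finite nonabelian group $G$ with center $Z(G)$, $X(G)$ is the $2$-dimensional simplicial complex with vertex set $\{(x,1): x\in G-Z(G)\}\sqcup\{(x,2): x\in G-Z(G)\}$ (type 1 and type 2 vertices), whose edges are $[(x,1),(y,1)]$ and $[(x,1),(y,2)]$ for all $x,y$ with $xy\ne yx$, and whose $2$-faces are $[(x,1),(y,1),(xy,2)]$ for all ordered pairs with $xy\neq yx$, oriented by the vertex order indicated. The link of every vertex is a disjoint union of finitely many circles. The desingularization $Y(G)$ is obtained by removing all vertices of $X(G)$ and filling in distinct punctures by distinct points (one new vertex, again labelled by $v$ and of the same type, for each vertex $v$ and each circle in the link of $v$); it has the same triangles as $X(G)$ and is a finite disjoint union of compact connected oriented triangulated surfaces, its components. In $Y(G)$ the closed star of each vertex is a single triangulated disk (its sheet). $\hat Y(G)$ is the same collection of surfaces with the cell structure whose vertices are the type 1 vertices,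 whose edges are those joining two type 1 vertices, and whose $2$-faces are the polygons formed by the sheets about type 2 vertices. $V$, $E$, $F$ are the numbers of vertices, edges and $2$-faces of this cell structure on a component; valency is the number of edges at a vertex. A component is viewed as an abstract $3$-polytope via the poset of its vertices, edges and $2$-faces ordered by inclusion, with a least (empty) face and a greatest $3$-face adjoined. It has Schläfli symbol $\{n,\lambda\}$ if all $2$-faces are $n$-gons and all vertices have valency $\lambda$, and it is regular if its automorphism group (order automorphisms of the poset) acts transitively on flags (maximal chains). *)

theory Defs
  imports
    "HOL-Algebra.Group"
    "Jordan_Normal_Form.Matrix"
    "Berlekamp_Zassenhaus.Finite_Field"
begin

text \<open>
  The field with \<open>p\<close> elements is \<open>'p mod_ring\<close>, where \<open>CARD('p) = p\<close> is prime.
\<close>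

definition U3 :: "'p::prime_card mod_ring mat monoid" where
  "U3 = \<lparr>carrier = {A \<in> carrier_mat 3 3. upper_triangular A \<and> (\<forall>i<3. A $$ (i, i) = 1)},
         mult = (*), one = 1\<^sub>m 3\<rparr>"

definition group_center :: "('a, 'b) monoid_scheme \<Rightarrow> 'a set" where
  "group_center G = {z \<in> carrier G. \<forall>x\<in>carrier G. z \<otimes>\<^bsub>G\<^esub> x = x \<otimes>\<^bsub>G\<^esub> z}"

definition noncommuting :: "('a, 'b) monoid_scheme \<Rightarrow> 'a \<Rightarrow> 'a \<Rightarrow> bool" where
  "noncommuting G x y \<longleftrightarrow> x \<in> carrier G \<and> y \<in> carrier G \<and> x \<otimes>\<^bsub>G\<^esub> y \<noteq> y \<otimes>\<^bsub>G\<^esub> x"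

text \<open>
  Edges are unordered pairs. A triangle is stored as a triple whose cyclic order is its
  orientation; its underlying simplex is \<open>tri_set\<close>.
\<close>

record 'v complex2 =
  vertices :: "'v set"
  edges :: "'v set set"
  triangles :: "('v \<times> 'v \<times> 'v) set"

fun tri_set :: "'v \<times> 'v \<times> 'v \<Rightarrow> 'v set" where
  "tri_set (a, b, c) = {a, b, c}"

fun tri_boundary :: "'v \<times> 'v \<times> 'v \<Rightarrow> ('v \<times> 'v) set" where
  "tri_boundary (a, b, c) = {(a, b), (b, c), (c, a)}"

definition simplices :: "'v complex2 \<Rightarrow> 'v set set" where
  "simplices K = {{v} | v. v \<in> vertices K} \<union> edges K \<union> tri_set ` triangles K"

definition graph_component :: "'v set set \<Rightarrow> 'v \<Rightarrow> 'v set" where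
  "graph_component E v = {w. (v, w) \<in> {(a, b). {a, b} \<in> E}\<^sup>*}"

definition link_vertices :: "'v complex2 \<Rightarrow> 'v \<Rightarrow> 'v set" where
  "link_vertices K v = {w. w \<noteq> v \<and> {v, w} \<in> edges K}"

definition link_edges :: "'v complex2 \<Rightarrow> 'v \<Rightarrow> 'v set set" where
  "link_edges K v = {s - {v} | s. s \<in> tri_set ` triangles K \<and> v \<in> s}"

definition is_circle :: "'v set \<Rightarrow> 'v set set \<Rightarrow> bool" where
  "is_circle V E \<longleftrightarrow> (\<exists>n\<ge>3. \<exists>c :: nat \<Rightarrow> 'v. inj_on c {..<n} \<and> V = c ` {..<n} \<and>
      E = {{c i, c (Suc i mod n)} | i. i < n})"

definition components :: "'v complex2 \<Rightarrow> 'v complex2 set" where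
  "components K =
    (\<lambda>C. \<lparr>vertices = C, edges = {e \<in> edges K. e \<subseteq> C},
          triangles = {t \<in> triangles K. tri_set t \<subseteq> C}\<rparr>) `
    graph_component (edges K) ` vertices K"

text \<open>
  A closed connected oriented triangulated surface: a finite connected simplicial complex
  in which every vertex link is a circle and every directed edge lies on the boundary of
  exactly one oriented triangle (so that the two triangles at an edge induce opposite
  orientations on it).
\<close>

definition closed_oriented_surface :: "'v complex2 \<Rightarrow> bool" where
  "closed_oriented_surface K \<longleftrightarrow>
    finite (vertices K) \<and> vertices K \<noteq> {} \<and>
    (\<forall>e\<in>edges K. e \<subseteq> vertices K \<and> card e = 2) \<and>
    (\<forall>t\<in>triangles K. tri_set t \<subseteq> vertices K \<and> card (tri_set t) = 3 \<and>
       (\<forall>e \<subseteq> tri_set t. card e = 2 \<longrightarrow> e \<in> edges K)) \<and>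
    inj_on tri_set (triangles K) \<and>
    (\<forall>v\<in>vertices K. \<forall>w\<in>vertices K. w \<in> graph_component (edges K) v) \<and>
    (\<forall>v\<in>vertices K. is_circle (link_vertices K v) (link_edges K v)) \<and>
    (\<forall>a b. a \<noteq> b \<and> {a, b} \<in> edges K \<longrightarrow> (\<exists>!t. t \<in> triangles K \<and> (a, b) \<in> tri_boundary t))"

definition euler_characteristic :: "'v complex2 \<Rightarrow> int" where
  "euler_characteristic K =
     int (card (vertices K)) - int (card (edges K)) + int (card (triangles K))"

definition closed_oriented_surface_of_genus :: "nat \<Rightarrow> 'v complex2 \<Rightarrow> bool" where
  "closed_oriented_surface_of_genus g K \<longleftrightarrow>
     closed_oriented_surface K \<and> euler_characteristic K = 2 - 2 * int g"

definition X :: "('a, 'b) monoid_scheme \<Rightarrow> ('a \<times> nat) complex2" where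
  "X G = \<lparr>
     vertices = (carrier G - group_center G) \<times> {1, 2},
     edges = {{(x, 1), (y, 1)} | x y. noncommuting G x y} \<union>
             {{(x, 1), (y, 2)} | x y. noncommuting G x y},
     triangles = {((x, 1), (y, 1), (x \<otimes>\<^bsub>G\<^esub> y, 2)) | x y. noncommuting G x y}\<rparr>"

text \<open>
  Removing the vertices of a complex whose links are disjoint unions of circles and filling
  in the punctures by distinct points: a vertex of the result is a pair \<open>(v, C)\<close> of a vertex
  \<open>v\<close> and (the vertex set of) a component \<open>C\<close> of its link. The end at \<open>v\<close> of an edge or
  triangle containing \<open>v\<close> and \<open>w\<close> becomes the pair whose second entry is the circle
  through \<open>w\<close>; in a triangle both other vertices lie on the same circle.
\<close>

definition puncture :: "'v complex2 \<Rightarrow> 'v \<Rightarrow> 'v \<Rightarrow> 'v \<times> 'v set" where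
  "puncture K v w = (v, graph_component (link_edges K v) w)"

definition desingularization :: "'v complex2 \<Rightarrow> ('v \<times> 'v set) complex2" where
  "desingularization K = \<lparr>
     vertices = {puncture K v w | v w. v \<in> vertices K \<and> w \<in> link_vertices K v},
     edges = {{puncture K v w, puncture K w v} | v w. v \<noteq> w \<and> {v, w} \<in> edges K},
     triangles = {(puncture K a b, puncture K b c, puncture K c a) | a b c.
                    (a, b, c) \<in> triangles K}\<rparr>"

definition Y :: "('a, 'b) monoid_scheme \<Rightarrow> (('a \<times> nat) \<times> ('a \<times> nat) set) complex2" where
  "Y G = desingularization (X G)"

text \<open>
  A closed cell is represented by the set of all (nonempty) simplices of the triangulated
  surface that it contains, so that inclusion of cells is literally \<open>\<subseteq>\<close>. The empty set
  is the empty face and \<open>simplices K\<close> is the whole surface.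
\<close>

type_synonym 'a vertexY = "('a \<times> nat) \<times> ('a \<times> nat) set"

definition vertex_type :: "'a vertexY \<Rightarrow> nat" where
  "vertex_type v = snd (fst v)"

definition closed_simplex :: "'v set \<Rightarrow> 'v set set" where
  "closed_simplex s = {r. r \<subseteq> s \<and> r \<noteq> {}}"

definition closed_star :: "'v complex2 \<Rightarrow> 'v \<Rightarrow> 'v set set" where
  "closed_star K v = \<Union> {closed_simplex s | s. s \<in> tri_set ` triangles K \<and> v \<in> s}"

definition hat_vertices :: "'a vertexY complex2 \<Rightarrow> 'a vertexY set set set" where
  "hat_vertices K = {closed_simplex {v} | v. v \<in> vertices K \<and> vertex_type v = 1}"

definition hat_edges :: "'a vertexY complex2 \<Rightarrow> 'a vertexY set set set" where
  "hat_edges K = {closed_simplex e | e. e \<in> edges K \<and> (\<forall>v\<in>e. vertex_type v = 1)}"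

definition hat_faces :: "'a vertexY complex2 \<Rightarrow> 'a vertexY set set set" where
  "hat_faces K = {closed_star K v | v. v \<in> vertices K \<and> vertex_type v = 2}"

definition hat_cells :: "'a vertexY complex2 \<Rightarrow> 'a vertexY set set set" where
  "hat_cells K = hat_vertices K \<union> hat_edges K \<union> hat_faces K"

definition hat_poset :: "'a vertexY complex2 \<Rightarrow> 'a vertexY set set set" where
  "hat_poset K = {{}} \<union> hat_cells K \<union> {simplices K}"

definition valency :: "'a vertexY complex2 \<Rightarrow> 'a vertexY set set \<Rightarrow> nat" where
  "valency K v = card {e \<in> hat_edges K. v \<subseteq> e}"

definition cell_isomorphic :: "'a vertexY complex2 \<Rightarrow> 'a vertexY complex2 \<Rightarrow> bool" where
  "cell_isomorphic K L \<longleftrightarrow> (\<exists>\<phi>. bij_betw \<phi> (hat_cells K) (hat_cells L) \<and>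
     \<phi> ` hat_vertices K = hat_vertices L \<and>
     \<phi> ` hat_edges K = hat_edges L \<and>
     \<phi> ` hat_faces K = hat_faces L \<and>
     (\<forall>x\<in>hat_cells K. \<forall>y\<in>hat_cells K. \<phi> x \<subseteq> \<phi> y \<longleftrightarrow> x \<subseteq> y))"

text \<open>
  A poset is a set \<open>P\<close> of elements of an ordered type with the induced order.
\<close>

definition flag :: "'f::order set \<Rightarrow> 'f set \<Rightarrow> bool" where
  "flag P F \<longleftrightarrow> pred_on.maxchain P (<) F"

text \<open>The rank of the least face is \<open>-1\<close>.\<close>

definition face_rank :: "'f::order set \<Rightarrow> 'f \<Rightarrow> int" where
  "face_rank P x = int (Max (card ` {C. pred_on.chain {y \<in> P. y < x} (<) C})) - 1"

definition faces :: "'f::order set \<Rightarrow> int \<Rightarrow> 'f set" where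
  "faces P i = {x \<in> P. face_rank P x = i}"

definition adjacent_flags :: "'f::order set \<Rightarrow> 'f set \<Rightarrow> 'f set \<Rightarrow> bool" where
  "adjacent_flags P A B \<longleftrightarrow> flag P A \<and> flag P B \<and> card (A - B) = 1 \<and> card (B - A) = 1"

definition strongly_flag_connected :: "'f::order set \<Rightarrow> bool" where
  "strongly_flag_connected P \<longleftrightarrow> (\<forall>F G. flag P F \<and> flag P G \<longrightarrow>
     (F, G) \<in> {(A, B). adjacent_flags P A B \<and> F \<inter> G \<subseteq> A \<and> F \<inter> G \<subseteq> B}\<^sup>*)"

text \<open>The axioms of McMullen and Schulte for an abstract polytope of rank \<open>n\<close>.\<close>

definition abstract_polytope :: "nat \<Rightarrow> 'f::order set \<Rightarrow> bool" where
  "abstract_polytope n P \<longleftrightarrow>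
     (\<exists>b\<in>P. \<forall>x\<in>P. b \<le> x) \<and> (\<exists>t\<in>P. \<forall>x\<in>P. x \<le> t) \<and>
     (\<forall>F. flag P F \<longrightarrow> finite F \<and> card F = n + 2) \<and>
     strongly_flag_connected P \<and>
     (\<forall>x\<in>P. \<forall>y\<in>P. x < y \<and> face_rank P y = face_rank P x + 2 \<longrightarrow>
        card {z \<in> P. x < z \<and> z < y} = 2)"

definition poset_automorphism :: "'f::order set \<Rightarrow> ('f \<Rightarrow> 'f) \<Rightarrow> bool" where
  "poset_automorphism P \<phi> \<longleftrightarrow>
     bij_betw \<phi> P P \<and> (\<forall>x\<in>P. \<forall>y\<in>P. \<phi> x \<le> \<phi> y \<longleftrightarrow> x \<le> y)"

definition flag_transitive :: "'f::order set \<Rightarrow> bool" where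
  "flag_transitive P \<longleftrightarrow>
     (\<forall>F G. flag P F \<and> flag P G \<longrightarrow> (\<exists>\<phi>. poset_automorphism P \<phi> \<and> \<phi> ` F = G))"

definition regular_polytope :: "nat \<Rightarrow> 'f::order set \<Rightarrow> bool" where
  "regular_polytope n P \<longleftrightarrow> abstract_polytope n P \<and> flag_transitive P"

text \<open>
  The face \<open>f\<close> is an \<open>n\<close>-gon: its vertices \<open>v 0, \<dots>, v (n - 1)\<close> and its edges
  \<open>e 0, \<dots>, e (n - 1)\<close> are distinct and \<open>e i\<close> joins \<open>v i\<close> to \<open>v (i + 1)\<close> cyclically.
\<close>

definition is_ngon :: "'f::order set \<Rightarrow> nat \<Rightarrow> 'f \<Rightarrow> bool" where
  "is_ngon P n f \<longleftrightarrow> n \<ge> 2 \<and> (\<exists>v e :: nat \<Rightarrow> 'f.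
     inj_on v {..<n} \<and> v ` {..<n} = {x \<in> faces P 0. x \<le> f} \<and>
     inj_on e {..<n} \<and> e ` {..<n} = {x \<in> faces P 1. x \<le> f} \<and>
     (\<forall>i<n. {x \<in> faces P 0. x \<le> e i} = {v i, v (Suc i mod n)}))"

definition has_schlafli_symbol :: "'f::order set \<Rightarrow> nat \<Rightarrow> nat \<Rightarrow> bool" where
  "has_schlafli_symbol P n l \<longleftrightarrow>
     (\<forall>f\<in>faces P 2. is_ngon P n f) \<and>
     (\<forall>v\<in>faces P 0. card {e \<in> faces P 1. v \<le> e} = l)"

text \<open>
  The 2-faces tessellate the triangulated surface \<open>K\<close> by \<open>n\<close>-gons: they are \<open>n\<close>-gons
  covering \<open>K\<close>, and two of them meet only in vertices and edges of the cell structure.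
\<close>

definition tessellates_with_ngons :: "'a vertexY complex2 \<Rightarrow> nat \<Rightarrow> bool" where
  "tessellates_with_ngons K n \<longleftrightarrow>
     (\<forall>f\<in>hat_faces K. is_ngon (hat_poset K) n f) \<and>
     \<Union> (hat_faces K) = simplices K \<and>
     (\<forall>f\<in>hat_faces K. \<forall>f'\<in>hat_faces K. f \<noteq> f' \<longrightarrow>
        f \<inter> f' \<subseteq> \<Union> (hat_vertices K \<union> hat_edges K))"

end

theory Submission
  imports Defs "HOL-Library.Product_Plus"
begin

text \<open>
  Let \<open>\<zeta>\<close> generate the center and let \<open>x\<close>, \<open>y\<close> be noncommuting elements. Only the cosets of the
  center matter for the links: the circle through \<open>y\<close> in the link of \<open>(x, 1)\<close> consists of the
  type 1 vertices over \<open>yZ\<close> and the type 2 vertices over \<open>xyZ\<close>, and the circle through \<open>x\<close> in the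
  link of \<open>(xy, 2)\<close> consists of the type 1 vertices over \<open>xZ\<close> and \<open>yZ\<close>. So the components of
  \<open>Y(G)\<close> correspond to unordered pairs of linearly independent vectors of \<open>G/Z\<close>, a plane over the
  field with \<open>p\<close> elements. Choosing \<open>\<zeta>\<close> to be the commutator of \<open>x\<close> and \<open>y\<close> and writing \<open>A\<^sub>i\<close>, \<open>B\<^sub>j\<close>,
  \<open>C\<^sub>k\<close> for the vertices over \<open>x\<zeta>\<^sup>i\<close>, \<open>y\<zeta>\<^sup>j\<close>, \<open>xy\<zeta>\<^sup>k\<close>, every component becomes the complete tripartite
  graph on the \<open>A\<^sub>i\<close>, \<open>B\<^sub>j\<close>, \<open>C\<^sub>k\<close> with the triangles \<open>A\<^sub>iB\<^sub>jC\<^bsub>i+j\<^esub>\<close> and \<open>B\<^sub>jA\<^sub>iC\<^bsub>i+j+1\<^esub>\<close>. Its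
  automorphisms \<open>(i, j, k) \<mapsto> (i + a, j + b, k + a + b)\<close>, \<open>(i, j, k) \<mapsto> (- i, - j, 1 - k)\<close> and the exchange
  of the \<open>A\<^sub>i\<close> with the \<open>B\<^sub>j\<close> act transitively on the flags.
\<close>

subsection \<open>Cyclic enumerations by a prime field\<close>

lemma of_nat_mod_ring_inj:
  assumes "(of_nat m :: 'p::prime_card mod_ring) = of_nat n" "m < CARD('p)" "n < CARD('p)"
  shows "m = n"
proof -
  have "m = n" if "(of_nat m :: 'p mod_ring) = of_nat n" "m \<le> n" "n < CARD('p)" for m n
  proof -
    have "of_nat (n - m) = (0 :: 'p mod_ring)"
      using that by (simp add: of_nat_diff)
    then have "CARD('p) dvd n - m"
      by (rule of_nat_0_mod_ring_dvd)
    then show ?thesis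
      using that by (auto dest: dvd_imp_le)
  qed
  then show ?thesis
    using assms by (metis nat_le_linear)
qed

text \<open>A nonzero \<open>c\<close> generates the additive group of a prime field, so a property
  stable under adding \<open>c\<close> spreads from one element to all. Flag connectivity and the
  connectedness of the link circles both rest on this.\<close>

lemma mod_ring_shift_induct:
  fixes t u c :: "'p::prime_card mod_ring"
  assumes "c \<noteq> 0" and "Q t" and "\<And>t. Q t \<Longrightarrow> Q (t + c)"
  shows "Q u"
proof -
  have "Q (t + of_nat n * c)" for n
    using assms(2) assms(3)[of "t + of_nat n * c" for n]
    by (induction n) (auto simp: algebra_simps)
  moreover obtain n where "(u - t) / c = of_nat n"
    using surj_of_nat_mod_ring by blast
  then have "u = t + of_nat n * c"
    using assms(1) by (simp add: field_simps)
  ultimately show ?thesis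
    by simp
qed

text \<open>The sequence f 0, g 0, f 1, g 1, ..., with natural number positions because
  \<open>is_ngon\<close> and \<open>is_circle\<close> index by them. It serves for the boundary of a
  2p-gon and for the vertex links.\<close>

definition interleave :: "('p::prime_card mod_ring \<Rightarrow> 'v) \<Rightarrow> ('p mod_ring \<Rightarrow> 'v) \<Rightarrow> nat \<Rightarrow> 'v" where
  "interleave f g m = (if even m then f else g) (of_nat (m div 2))"

lemma inj_on_interleave:
  fixes f g :: "'p::prime_card mod_ring \<Rightarrow> 'v"
  assumes "inj f" "inj g" "range f \<inter> range g = {}"
  shows "inj_on (interleave f g) {..<2 * CARD('p)}"
proof (rule inj_onI)
  fix m n
  assume mn: "m \<in> {..<2 * CARD('p)}" "n \<in> {..<2 * CARD('p)}"
    and eq: "interleave f g m = interleave f g n"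
  have *: "even m = even n"
    using eq assms(3) by (auto simp: interleave_def split: if_splits)
  then have "(of_nat (m div 2) :: 'p mod_ring) = of_nat (n div 2)"
    using eq injD[OF assms(1)] injD[OF assms(2)] by (auto simp: interleave_def split: if_splits)
  then have "m div 2 = n div 2"
    by (rule of_nat_mod_ring_inj) (use mn in auto)
  with * show "m = n"
    by (metis dvd_mult_div_cancel odd_two_times_div_two_succ)
qed

lemma interleave_even [simp]: "interleave f g (2 * n) = f (of_nat n)"
  by (simp add: interleave_def)

lemma interleave_odd [simp]: "interleave f g (Suc (2 * n)) = g (of_nat n)"
  by (simp add: interleave_def)

lemma image_interleave:
  fixes f g :: "'p::prime_card mod_ring \<Rightarrow> 'v"
  shows "interleave f g ` {..<2 * CARD('p)} = range f \<union> range g"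
proof
  show "range f \<union> range g \<subseteq> interleave f g ` {..<2 * CARD('p)}"
  proof safe
    fix x :: "'p mod_ring"
    obtain n where n: "n < CARD('p)" "x = of_nat n"
      using surj_of_nat_mod_ring by blast
    show "f x \<in> interleave f g ` {..<2 * CARD('p)}"
      using n by (intro image_eqI[of _ _ "2 * n"]) auto
    show "g x \<in> interleave f g ` {..<2 * CARD('p)}"
      using n by (intro image_eqI[of _ _ "Suc (2 * n)"]) auto
  qed
qed (auto simp: interleave_def)

text \<open>The wrap from the last position back to 0 obeys the same formula as any other odd
  position, since (p - 1) + 1 = 0 in the field.\<close>

lemma interleave_Suc_mod:
  fixes f g :: "'p::prime_card mod_ring \<Rightarrow> 'v"
  assumes "i < 2 * CARD('p)"
  shows "interleave f g (Suc i mod (2 * CARD('p))) =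
    (if even i then g (of_nat (i div 2)) else f (of_nat (i div 2) + 1))"
proof (cases "even i")
  case True
  then have "Suc i < 2 * CARD('p)"
    using assms by presburger
  with True show ?thesis
    by (auto simp: interleave_def)
next
  case False
  then obtain n where i: "i = Suc (2 * n)"
    by (auto elim: oddE)
  show ?thesis
  proof (cases "Suc n = CARD('p)")
    case True
    then have "Suc i mod (2 * CARD('p)) = 2 * 0"
      using i by (metis mod_mult_self1_is_0 mult_Suc_right add_2_eq_Suc mult_0_right mod_self)
    moreover have "of_nat n + 1 = (0 :: 'p mod_ring)"
      using of_nat_card_eq_0[where 'a = 'p] True by (metis of_nat_Suc add.commute)
    ultimately show ?thesis
      using i by (simp only: interleave_even) simp
  next
    case neq: False
    then have "Suc i mod (2 * CARD('p)) = 2 * Suc n"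
      using i assms by simp
    then show ?thesis
      using i by (simp only: interleave_even) (simp add: add.commute)
  qed
qed

subsection \<open>The abstract polytope\<close>

text \<open>\<open>Vert True i\<close> and \<open>Vert False j\<close> are the vertices
  \<open>A\<^sub>i\<close> and \<open>B\<^sub>j\<close>, \<open>Edge i j\<close> joins them, and
  \<open>Face k\<close> is the polygon about \<open>C\<^sub>k\<close>.\<close>

datatype 'i cell = Least | Vert bool 'i | Edge 'i 'i | Face 'i | Greatest

text \<open>Every vertex lies on every polygon. The edge from \<open>A\<^sub>i\<close> to
  \<open>B\<^sub>j\<close> lies in one triangle of each orientation, with centres i + j and i + j +
  1, hence on exactly these two polygons.\<close>

fun cell_le :: "'i::comm_ring_1 cell \<Rightarrow> 'i cell \<Rightarrow> bool" where
  "cell_le Least y = True"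
| "cell_le (Vert s a) y = (case y of Least \<Rightarrow> False | Vert t b \<Rightarrow> s = t \<and> a = b
     | Edge i j \<Rightarrow> a = (if s then i else j) | _ \<Rightarrow> True)"
| "cell_le (Edge i j) y = (case y of Edge k l \<Rightarrow> i = k \<and> j = l
     | Face k \<Rightarrow> k = i + j \<or> k = i + j + 1 | Greatest \<Rightarrow> True | _ \<Rightarrow> False)"
| "cell_le (Face k) y = (case y of Face l \<Rightarrow> k = l | Greatest \<Rightarrow> True | _ \<Rightarrow> False)"
| "cell_le Greatest y = (y = Greatest)"

fun cell_rank :: "'i cell \<Rightarrow> int" where
  "cell_rank Least = - 1"
| "cell_rank (Vert s a) = 0"
| "cell_rank (Edge i j) = 1"
| "cell_rank (Face k) = 2"
| "cell_rank Greatest = 3"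

lemma cell_le_refl: "cell_le x x"
  by (cases x) auto

lemma cell_le_antisym: "cell_le x y \<Longrightarrow> cell_le y x \<Longrightarrow> x = y"
  by (cases x; cases y) auto

lemma cell_rank_less: "cell_le x y \<Longrightarrow> x \<noteq> y \<Longrightarrow> cell_rank x < cell_rank y"
  by (cases x; cases y) auto

text \<open>The edge seen from its end on side \<open>s\<close> with index \<open>a\<close>; the
  other end has index \<open>b\<close>. Both sides can then be treated at once.\<close>

definition edge_at :: "bool \<Rightarrow> 'i \<Rightarrow> 'i \<Rightarrow> 'i cell" where
  "edge_at s a b = (if s then Edge a b else Edge b a)"

text \<open>The last argument selects one of the two faces at the edge.\<close>

definition std_flag :: "bool \<Rightarrow> 'i::comm_ring_1 \<Rightarrow> 'i \<Rightarrow> bool \<Rightarrow> 'i cell set" where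
  "std_flag s a b d = {Least, Vert s a, edge_at s a b, Face (a + b + of_bool d), Greatest}"

lemma finite_std_flag: "finite (std_flag s a b d)"
  by (simp add: std_flag_def)

lemma std_flag_chain:
  "x \<in> std_flag s a b d \<Longrightarrow> y \<in> std_flag s a b d \<Longrightarrow> cell_le x y \<or> cell_le y x"
  by (cases s) (auto simp: std_flag_def edge_at_def)

text \<open>Distinct cells of equal rank are incomparable, so comparing \<open>x\<close> with the
  member of its own rank identifies it.\<close>

lemma std_flag_maximal:
  assumes "\<And>y. y \<in> std_flag s a b d \<Longrightarrow> cell_le x y \<or> cell_le y x"
  shows "x \<in> std_flag s a b d"
  using assms[of "Vert s a"] assms[of "edge_at s a b"] assms[of "Face (a + b + of_bool d)"]
  by (cases x) (auto simp: std_flag_def edge_at_def split: if_splits)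

lemma std_flag_through:
  fixes D :: "'i::comm_ring_1 cell set"
  assumes chain: "\<And>x y. x \<in> D \<Longrightarrow> y \<in> D \<Longrightarrow> cell_le x y \<or> cell_le y x"
  shows "\<exists>s a b d. D \<subseteq> std_flag s a b d"
proof (cases "\<exists>i j. Edge i j \<in> D")
  case True
  then obtain i j where e: "Edge i j \<in> D"
    by blast
  \<comment> \<open>The parameters are read off from the members of \<open>D\<close>. A missing
    vertex gives side \<open>False\<close> and a missing face gives \<open>d = False\<close>, which
    are harmless defaults.\<close>
  define s where "s = (\<exists>a. Vert True a \<in> D)"
  define a where "a = (if s then i else j)"
  define b where "b = (if s then j else i)"
  define d where "d = (\<exists>k. Face k \<in> D \<and> k \<noteq> i + j)"
  have "x \<in> std_flag s a b d" if x: "x \<in> D" for x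
  proof (cases x)
    case (Vert t c)
    then show ?thesis
      using x chain[OF x e] chain[OF x, of "Vert True c'" for c']
      by (cases t) (auto simp: std_flag_def s_def a_def b_def edge_at_def)
  next
    case (Edge k l)
    then show ?thesis
      using chain[OF x e] by (auto simp: std_flag_def a_def b_def edge_at_def)
  next
    case (Face k)
    then show ?thesis
      using chain[OF x e] chain[OF x, of "Face k'" for k'] x
      by (auto simp: std_flag_def a_def b_def d_def add.commute split: if_splits)
  qed (auto simp: std_flag_def)
  then show ?thesis
    by blast
next
  case False
  obtain s a where v: "\<And>t c. Vert t c \<in> D \<Longrightarrow> t = s \<and> c = a"
  proof -
    have "t = t' \<and> c = c'" if "Vert t c \<in> D" "Vert t' c' \<in> D" for t t' c c'
      using chain[OF that] by auto
    then show ?thesis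
      using that by metis
  qed
  obtain k where k: "\<And>l. Face l \<in> D \<Longrightarrow> l = k"
  proof -
    have "l = l'" if "Face l \<in> D" "Face l' \<in> D" for l l'
      using chain[OF that] by auto
    then show ?thesis
      using that by metis
  qed
  \<comment> \<open>Since every vertex lies on every polygon, an edge can be inserted: the one from
    the vertex with index \<open>a\<close> to index \<open>k - a\<close> has \<open>Face k\<close>
    as its first face. If \<open>D\<close> lacks a vertex or a face, the corresponding parameters
    are arbitrary.\<close>
  have "D \<subseteq> std_flag s a (k - a) False"
  proof
    fix x assume "x \<in> D"
    then show "x \<in> std_flag s a (k - a) False"
      using False v k by (cases x) (auto simp: std_flag_def)
  qed
  then show ?thesis
    by blast
qed

subsubsection \<open>Connectedness of the flags\<close>

text \<open>Adjacency of flags as in strong flag connectivity, expressed on abstract cells.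
  \<open>S\<close> will be the intersection of the two flags to be joined.\<close>

definition flag_step :: "'i::comm_ring_1 cell set \<Rightarrow> ('i cell set \<times> 'i cell set) set" where
  "flag_step S = {(A, B). (\<exists>s a b d. A = std_flag s a b d) \<and> (\<exists>s a b d. B = std_flag s a b d) \<and>
     card (A - B) = 1 \<and> card (B - A) = 1 \<and> S \<subseteq> A \<and> S \<subseteq> B}"

lemma flag_stepI:
  assumes "std_flag s a b d - std_flag s' a' b' d' = {x}"
    and "std_flag s' a' b' d' - std_flag s a b d = {y}"
    and "S \<subseteq> std_flag s a b d \<inter> std_flag s' a' b' d'"
  shows "(std_flag s a b d, std_flag s' a' b' d') \<in> flag_step S"
  using assms unfolding flag_step_def by auto

lemma sym_flag_step: "sym (flag_step S)"
  by (auto simp: sym_def flag_step_def)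

lemma flag_step_rtrancl_sym: "(A, B) \<in> (flag_step S)\<^sup>* \<Longrightarrow> (B, A) \<in> (flag_step S)\<^sup>*"
  using sym_rtrancl[OF sym_flag_step] by (auto dest: symD)

lemma flag_step_vertex:
  assumes "S \<subseteq> {Least, edge_at s a b, Face (a + b + of_bool d), Greatest}"
  shows "(std_flag s a b d, std_flag (\<not> s) b a d) \<in> flag_step S"
  by (rule flag_stepI[where x = "Vert s a" and y = "Vert (\<not> s) b"])
     (use assms in \<open>auto simp: std_flag_def edge_at_def add.commute\<close>)

lemma flag_step_face:
  assumes "S \<subseteq> {Least, Vert s a, edge_at s a b, Greatest}"
  shows "(std_flag s a b d, std_flag s a b (\<not> d)) \<in> flag_step S"
  by (rule flag_stepI[where x = "Face (a + b + of_bool d)" and y = "Face (a + b + of_bool (\<not> d))"])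
     (use assms in \<open>auto simp: std_flag_def edge_at_def\<close>)

text \<open>With the vertex and the polygon k = a + b fixed, the other edge of that polygon at the
  vertex ends at \<open>b - 1\<close>. For that edge k is the second face, so the bit changes from
  \<open>False\<close> to \<open>True\<close>.\<close>

lemma flag_step_edge:
  assumes "S \<subseteq> {Least, Vert s a, Face (a + b), Greatest}"
  shows "(std_flag s a b False, std_flag s a (b - 1) True) \<in> flag_step S"
  by (rule flag_stepI[where x = "edge_at s a b" and y = "edge_at s a (b - 1)"])
     (use assms in \<open>auto simp: std_flag_def edge_at_def\<close>)

text \<open>Rotation about a vertex: an edge exchange followed by a face exchange lowers
  \<open>b\<close> by 1, and these steps reach every edge at the vertex.\<close>

lemma flags_vertex_connected:
  fixes a b :: "'p::prime_card mod_ring"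
  assumes S: "S \<subseteq> {Least, Vert s a, Greatest}"
  shows "(std_flag s a b d, std_flag s a b' d') \<in> (flag_step S)\<^sup>*"
proof -
  have flip: "(std_flag s a b d, std_flag s a b d') \<in> (flag_step S)\<^sup>*" for b d d'
    using flag_step_face[of S s a b d] S by (cases "d = d'") auto
  have "(std_flag s a b False, std_flag s a b' False) \<in> (flag_step S)\<^sup>*"
  proof (rule mod_ring_shift_induct[of "- 1" _ b])
    fix c
    assume "(std_flag s a b False, std_flag s a c False) \<in> (flag_step S)\<^sup>*"
    also have "(std_flag s a c False, std_flag s a (c - 1) True) \<in> flag_step S"
      by (rule flag_step_edge) (use S in auto)
    also have "(std_flag s a (c - 1) True, std_flag s a (c - 1) False) \<in> (flag_step S)\<^sup>*"
      by (rule flip)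
    finally show "(std_flag s a b False, std_flag s a (c + - 1) False) \<in> (flag_step S)\<^sup>*"
      by simp
  qed auto
  then show ?thesis
    using flip by (meson rtrancl_trans)
qed

text \<open>Walking along the boundary of the polygon \<open>k\<close>. Flags are first brought to
  the form \<open>d = False\<close>, where \<open>b\<close> is determined as
  \<open>k - a\<close>.\<close>

lemma flags_face_connected:
  fixes a b :: "'p::prime_card mod_ring"
  assumes S: "S \<subseteq> {Least, Face k, Greatest}"
    and k: "a + b + of_bool d = k" "a' + b' + of_bool d' = k"
  shows "(std_flag s a b d, std_flag s' a' b' d') \<in> (flag_step S)\<^sup>*"
proof -
  \<comment> \<open>Two edge exchanges and two vertex exchanges advance by two edges of the polygon:
    the vertex is back on its side, with index raised by 1.\<close>
  have turn: "(std_flag s a (k - a) False, std_flag s a' (k - a') False) \<in> (flag_step S)\<^sup>*"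
    for s a a'
  proof (rule mod_ring_shift_induct[of 1 "\<lambda>x. (std_flag s a (k - a) False, std_flag s x (k - x) False)
      \<in> (flag_step S)\<^sup>*" a])
    fix c
    assume "(std_flag s a (k - a) False, std_flag s c (k - c) False) \<in> (flag_step S)\<^sup>*"
    also have "(std_flag s c (k - c) False, std_flag s c (k - c - 1) True) \<in> flag_step S"
      by (rule flag_step_edge) (use S in auto)
    also have "(std_flag s c (k - c - 1) True, std_flag (\<not> s) (k - c - 1) c True) \<in> flag_step S"
      by (rule flag_step_vertex) (use S in auto)
    also have "(std_flag (\<not> s) (k - c - 1) c True, std_flag (\<not> s) (k - c - 1) (c + 1) False) \<in> flag_step S"
      by (rule symD[OF sym_flag_step])
         (use flag_step_edge[of S "\<not> s" "k - c - 1" "c + 1"] S in auto)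
    also have "(std_flag (\<not> s) (k - c - 1) (c + 1) False, std_flag s (c + 1) (k - c - 1) False)
        \<in> flag_step S"
      using flag_step_vertex[of S "\<not> s" "k - c - 1" "c + 1" False] S by auto
    finally show "(std_flag s a (k - a) False, std_flag s (c + 1) (k - (c + 1)) False) \<in> (flag_step S)\<^sup>*"
      by (simp add: diff_diff_eq)
  qed auto
  have flip: "(std_flag s a (k - a) False, std_flag s' a' (k - a') False) \<in> (flag_step S)\<^sup>*" for s s' a a'
  proof (cases "s = s'")
    case False
    then have "s' = (\<not> s)" by auto
    then have "(std_flag s a (k - a) False, std_flag s' (k - a) a False) \<in> flag_step S"
      using flag_step_vertex[of S s a "k - a" False] S by auto
    also have "(std_flag s' (k - a) a False, std_flag s' a' (k - a') False) \<in> (flag_step S)\<^sup>*"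
      using turn[of s' "k - a" a'] by simp
    finally show ?thesis .
  qed (use turn in auto)
  have norm: "(std_flag s a b d, std_flag s a (k - a) False) \<in> (flag_step S)\<^sup>*"
    if "a + b + of_bool d = k" for s a b d
  proof (cases d)
    case True
    have "S \<subseteq> {Least, Vert s a, Face (a + (b + 1)), Greatest}"
      using S that True by (auto simp: add.assoc)
    from flag_step_edge[OF this] have "(std_flag s a (k - a) False, std_flag s a b d) \<in> flag_step S"
      using that True by (auto simp: algebra_simps)
    then show ?thesis
      by (auto intro: symD[OF sym_flag_step])
  next
    case False
    then show ?thesis
      using that by (auto simp: algebra_simps)
  qed
  show ?thesis
    using norm[OF k(1)] flip flag_step_rtrancl_sym[OF norm[OF k(2)]] by (meson rtrancl_trans)
qed

text \<open>The edges form a complete bipartite graph: rotating about a vertex finds the edge to any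
  prescribed vertex of the other side, and a vertex exchange crosses over. Ending on the same side
  takes two crossings.\<close>

lemma flags_connected:
  fixes a b :: "'p::prime_card mod_ring"
  assumes S: "S \<subseteq> {Least, Greatest}"
  shows "(std_flag s a b d, std_flag s' a' b' d') \<in> (flag_step S)\<^sup>*"
proof -
  have move: "(std_flag s a b d, std_flag (\<not> s) a' b' d') \<in> (flag_step S)\<^sup>*" for s a b d a' b' d'
  proof -
    have "(std_flag s a b d, std_flag s a a' d) \<in> (flag_step S)\<^sup>*"
      by (rule flags_vertex_connected) (use S in auto)
    also have "(std_flag s a a' d, std_flag (\<not> s) a' a d) \<in> flag_step S"
      by (rule flag_step_vertex) (use S in auto)
    also have "(std_flag (\<not> s) a' a d, std_flag (\<not> s) a' b' d') \<in> (flag_step S)\<^sup>*"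
      by (rule flags_vertex_connected) (use S in auto)
    finally show ?thesis .
  qed
  show ?thesis
    using move[of s a b d a b d] move[of "\<not> s" a b d a' b' d'] move[of s a b d a' b' d']
    by (cases "s' = s") (auto intro: rtrancl_trans)
qed

text \<open>The common cells dictate the moves. With a common edge, exchange face and vertex
  directly; with a common vertex but no common edge, rotate about it or exchange the edge; with only
  a polygon in common, walk along its boundary; otherwise all moves are free.\<close>

lemma std_flags_strongly_connected:
  fixes a b :: "'p::prime_card mod_ring"
  defines "A \<equiv> \<lambda>s a b d. std_flag s (a :: 'p mod_ring) b d"
  shows "(A s a b d, A s' a' b' d') \<in> (flag_step (A s a b d \<inter> A s' a' b' d'))\<^sup>*"
proof -
  let ?S = "A s a b d \<inter> A s' a' b' d'"
  consider (edge) "edge_at s a b = edge_at s' a' b'"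
    | (vertex) "edge_at s a b \<noteq> edge_at s' a' b'" "s = s'" "a = a'"
    | (face) "edge_at s a b \<noteq> edge_at s' a' b'" "(s, a) \<noteq> (s', a')"
        "a + b + of_bool d = a' + b' + of_bool d'"
    | (none) "edge_at s a b \<noteq> edge_at s' a' b'" "(s, a) \<noteq> (s', a')"
        "a + b + of_bool d \<noteq> a' + b' + of_bool d'"
    by (cases "edge_at s a b = edge_at s' a' b'"; cases "(s, a) = (s', a')";
        cases "a + b + of_bool d = a' + b' + of_bool d'") auto
  then show ?thesis
  proof cases
    case edge
    have face: "(A s' a' b' d, A s' a' b' d') \<in> (flag_step ?S)\<^sup>*"
    proof (cases "d = d'")
      case False
      then have "d' = (\<not> d)" by auto
      then show ?thesis
        using flag_step_face[of ?S s' a' b' d] edge False unfolding A_def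
        by (auto simp: std_flag_def edge_at_def split: if_splits)
    qed auto
    show ?thesis
    proof (cases "s = s'")
      case True
      then show ?thesis
        using edge face by (auto simp: edge_at_def split: if_splits)
    next
      case False
      then have "s' = (\<not> s)" "a' = b" "b' = a"
        using edge by (auto simp: edge_at_def split: if_splits)
      then have "(A s a b d, A s' a' b' d) \<in> flag_step ?S"
        using flag_step_vertex[of ?S s a b d] unfolding A_def
        by (auto simp: std_flag_def edge_at_def split: if_splits)
      then show ?thesis
        using face by (rule converse_rtrancl_into_rtrancl)
    qed
  next
    case vertex
    show ?thesis
    proof (cases "a + b + of_bool d = a' + b' + of_bool d'")
      case True
      \<comment> \<open>With vertex and polygon in common, the two edges are the two edges of that
        polygon at that vertex, so the flags are already adjacent.\<close>
      then have "d \<noteq> d'"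
        using vertex by (auto simp: edge_at_def)
      then have "(A s a b d, A s' a' b' d') \<in> flag_step ?S"
        unfolding A_def
        by (intro flag_stepI[where x = "edge_at s a b" and y = "edge_at s' a' b'"])
           (use vertex True in \<open>auto simp: std_flag_def edge_at_def split: if_splits\<close>)
      then show ?thesis
        by auto
    next
      case False
      have "?S \<subseteq> {Least, Vert s a, Greatest}"
        using vertex False unfolding A_def
        by (auto simp: std_flag_def edge_at_def split: if_splits)
      then show ?thesis
        using flags_vertex_connected vertex unfolding A_def by blast
    qed
  next
    case face
    then have "?S \<subseteq> {Least, Face (a + b + of_bool d), Greatest}"
      unfolding A_def by (auto simp: std_flag_def edge_at_def split: if_splits)
    then show ?thesis
      using flags_face_connected face(3) unfolding A_def by metis
  next
    case none
    then have "?S \<subseteq> {Least, Greatest}"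
      unfolding A_def by (auto simp: std_flag_def edge_at_def split: if_splits)
    then show ?thesis
      using flags_connected unfolding A_def by blast
  qed
qed

subsubsection \<open>Realizations of the polytope\<close>

text \<open>A realization of the abstract cells as a poset of sets or other ordered objects. All
  polytope properties are proved here once and inherited by every component.\<close>

locale cell_poset =
  fixes P :: "'f::order set" and \<phi> :: "'p::prime_card mod_ring cell \<Rightarrow> 'f"
  assumes range: "range \<phi> = P" and le: "\<phi> x \<le> \<phi> y \<longleftrightarrow> cell_le x y"
begin

lemma inj: "inj \<phi>"
  by (rule injI) (metis cell_le_antisym le order_refl)

lemma eq_iff [simp]: "\<phi> x = \<phi> y \<longleftrightarrow> x = y"
  using inj by (auto dest: injD)

lemma less: "\<phi> x < \<phi> y \<longleftrightarrow> cell_le x y \<and> x \<noteq> y"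
  by (simp add: less_le le)

lemma mem [simp]: "\<phi> x \<in> P"
  using range by auto

section \<open>Flags of a realization\<close>

lemma chain_iff: "pred_on.chain P (<) (\<phi> ` A) \<longleftrightarrow> (\<forall>x\<in>A. \<forall>y\<in>A. cell_le x y \<or> cell_le y x)"
proof -
  have "(\<phi> x < \<phi> y \<or> \<phi> x = \<phi> y) \<or> (\<phi> y < \<phi> x \<or> \<phi> y = \<phi> x) \<longleftrightarrow> cell_le x y \<or> cell_le y x" for x y
    using cell_le_refl by (auto simp: less)
  then show ?thesis
    unfolding pred_on.chain_def by (simp add: image_subset_iff)
qed

text \<open>Every chain extends to a standard flag, and standard flags are maximal chains by
  \<open>std_flag_maximal\<close>.\<close>

lemma flag_iff: "flag P F \<longleftrightarrow> (\<exists>s a b d. F = \<phi> ` std_flag s a b d)"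
proof
  assume F: "flag P F"
  then obtain A where A: "F = \<phi> ` A"
    unfolding flag_def pred_on.maxchain_def pred_on.chain_def using range
    by (auto simp: subset_image_iff)
  have "\<exists>s a b d. A \<subseteq> std_flag s a b d"
    by (rule std_flag_through)
       (use F in \<open>auto simp: A flag_def pred_on.maxchain_def chain_iff\<close>)
  then obtain s a b d where B: "A \<subseteq> std_flag s a b d"
    by blast
  have "pred_on.chain P (<) (\<phi> ` std_flag s a b d)"
    unfolding chain_iff using std_flag_chain by blast
  then have "F = \<phi> ` std_flag s a b d"
    using F A B unfolding flag_def pred_on.maxchain_def by (metis image_mono psubsetI)
  then show "\<exists>s a b d. F = \<phi> ` std_flag s a b d"
    by blast
next
  assume "\<exists>s a b d. F = \<phi> ` std_flag s a b d"
  then obtain s a b d where F: "F = \<phi> ` std_flag s a b d"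
    by blast
  have "\<not> \<phi> ` std_flag s a b d \<subset> S" if S: "pred_on.chain P (<) S" for S
  proof
    assume sub: "\<phi> ` std_flag s a b d \<subset> S"
    obtain A where A: "S = \<phi> ` A"
      using S range unfolding pred_on.chain_def by (auto simp: subset_image_iff)
    have "std_flag s a b d \<subseteq> A"
      using sub A by auto
    moreover have "A \<subseteq> std_flag s a b d"
    proof
      fix x assume "x \<in> A"
      with S calculation show "x \<in> std_flag s a b d"
        unfolding A chain_iff by (intro std_flag_maximal) blast
    qed
    ultimately show False
      using sub A by auto
  qed
  then have "\<nexists>S. pred_on.chain P (<) S \<and> \<phi> ` std_flag s a b d \<subset> S"
    by auto
  moreover have "pred_on.chain P (<) (\<phi> ` std_flag s a b d)"
    unfolding chain_iff using std_flag_chain by blast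
  ultimately show "flag P F"
    unfolding flag_def pred_on.maxchain_def F by (intro conjI)
qed

section \<open>Ranks of the faces\<close>

lemma exists_chain_below:
  "\<exists>A. (\<forall>x\<in>A. \<forall>y\<in>A. cell_le x y \<or> cell_le y x) \<and> (\<forall>y\<in>A. cell_le y x \<and> y \<noteq> x) \<and>
    int (card A) = cell_rank x + 1" for x :: "'p mod_ring cell"
proof (cases x)
  case Least
  then show ?thesis by (intro exI[of _ "{}"]) auto
next
  case (Vert s a)
  then show ?thesis by (intro exI[of _ "{Least}"]) auto
next
  case (Edge i j)
  then show ?thesis by (intro exI[of _ "{Least, Vert True i}"]) auto
next
  case (Face k)
  then show ?thesis by (intro exI[of _ "{Least, Vert True k, Edge k 0}"]) auto
next
  case Greatest
  then show ?thesis by (intro exI[of _ "{Least, Vert True 0, Edge 0 0, Face 0}"]) auto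
qed

text \<open>\<open>cell_rank\<close> is injective on a chain, so a chain strictly below
  \<open>x\<close> has at most as many members as there are ranks from -1 up to that of
  \<open>x\<close>, exclusive. The explicit chains of \<open>exists_chain_below\<close> attain this
  bound.\<close>

lemma face_rank [simp]: "face_rank P (\<phi> x) = cell_rank x"
proof -
  let ?C = "{C. pred_on.chain {y \<in> P. y < \<phi> x} (<) C}"
  have image: "\<exists>A. C = \<phi> ` A \<and> (\<forall>u\<in>A. \<forall>v\<in>A. cell_le u v \<or> cell_le v u) \<and>
      (\<forall>y\<in>A. cell_le y x \<and> y \<noteq> x)" if "C \<in> ?C" for C
  proof -
    have "C \<subseteq> range \<phi>"
      using that range by (auto simp: pred_on.chain_def)
    then obtain A where "C = \<phi> ` A"
      by (auto simp: subset_image_iff)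
    moreover have "pred_on.chain P (<) C"
      using that by (auto simp: pred_on.chain_def)
    ultimately show ?thesis
      using that \<open>C = \<phi> ` A\<close>
      by (intro exI[of _ A]) (auto simp: chain_iff pred_on.chain_def[of "{y \<in> P. y < \<phi> x}"] less)
  qed
  have bound: "card C \<le> nat (cell_rank x + 1)" if C: "C \<in> ?C" for C
  proof -
    obtain A where A: "C = \<phi> ` A" "\<forall>u\<in>A. \<forall>v\<in>A. cell_le u v \<or> cell_le v u"
      "\<forall>y\<in>A. cell_le y x \<and> y \<noteq> x"
      using image[OF C] by (elim exE conjE)
    have "card C = card A"
      unfolding A(1) by (rule card_image) (use inj in \<open>auto intro: inj_on_subset\<close>)
    also have "\<dots> \<le> card {- 1..<cell_rank x}"
    proof (rule card_inj_on_le[of cell_rank])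
      show "inj_on cell_rank A"
        using A(2) by (auto simp: inj_on_def) (metis cell_rank_less less_irrefl)
      have "- 1 \<le> cell_rank y" for y :: "'p mod_ring cell"
        by (cases y) auto
      moreover have "cell_rank y < cell_rank x" if "y \<in> A" for y
        by (rule cell_rank_less) (use A(3) that in auto)
      ultimately show "cell_rank ` A \<subseteq> {- 1..<cell_rank x}"
        by auto
    qed auto
    finally show ?thesis
      by simp
  qed
  obtain A where A: "\<forall>x\<in>A. \<forall>y\<in>A. cell_le x y \<or> cell_le y x"
      "\<forall>y\<in>A. cell_le y x \<and> y \<noteq> x" "int (card A) = cell_rank x + 1"
    using exists_chain_below[of x] by (elim exE conjE)
  have chain: "\<phi> ` A \<in> ?C"
    using A(1,2) by (auto simp: pred_on.chain_def less cell_le_refl)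
  have "nat (cell_rank x + 1) = card (\<phi> ` A)"
    using A(3) inj by (subst card_image) (auto intro: inj_on_subset)
  then have attained: "nat (cell_rank x + 1) \<in> card ` ?C"
    using chain by (rule image_eqI)
  have "Max (card ` ?C) = nat (cell_rank x + 1)"
  proof (rule Max_eqI)
    have "card ` ?C \<subseteq> {..nat (cell_rank x + 1)}"
      using bound by (simp add: image_subset_iff)
    then show "finite (card ` ?C)"
      by (rule finite_subset) simp
    show "n \<le> nat (cell_rank x + 1)" if "n \<in> card ` ?C" for n
      using that bound by (elim imageE) simp
  qed (rule attained)
  then show ?thesis
    unfolding face_rank_def using A(3) by simp
qed

lemma faces_eq: "faces P n = \<phi> ` {x. cell_rank x = n}"
proof -
  have "faces P n = {x \<in> range \<phi>. face_rank P x = n}"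
    unfolding faces_def range ..
  then show ?thesis
    by auto
qed

lemma faces_0: "faces P 0 = range (\<lambda>(s, a). \<phi> (Vert s a))"
proof -
  have "{x. cell_rank x = 0} = range (\<lambda>(s, a :: 'p mod_ring). Vert s a)"
  proof safe
    fix x :: "'p mod_ring cell"
    assume "cell_rank x = 0"
    then show "x \<in> range (\<lambda>(s, a). Vert s a)"
      by (cases x) auto
  qed auto
  then show ?thesis
    by (auto simp: faces_eq)
qed

lemma faces_1: "faces P 1 = range (\<lambda>(i, j). \<phi> (Edge i j))"
proof -
  have "{x. cell_rank x = 1} = range (\<lambda>(i :: 'p mod_ring, j). Edge i j)"
  proof safe
    fix x :: "'p mod_ring cell"
    assume "cell_rank x = 1"
    then show "x \<in> range (\<lambda>(i, j). Edge i j)"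
      by (cases x) auto
  qed auto
  then show ?thesis
    by (auto simp: faces_eq)
qed

lemma faces_2: "faces P 2 = range (\<lambda>k. \<phi> (Face k))"
proof -
  have "{x. cell_rank x = 2} = range (Face :: 'p mod_ring \<Rightarrow> _)"
  proof safe
    fix x :: "'p mod_ring cell"
    assume "cell_rank x = 2"
    then show "x \<in> range Face"
      by (cases x) auto
  qed auto
  then show ?thesis
    by (auto simp: faces_eq)
qed

section \<open>The axioms of an abstract polytope\<close>

lemma strongly_flag_connected: "strongly_flag_connected P"
proof -
  let ?R = "\<lambda>S. {(A, B). adjacent_flags P A B \<and> S \<subseteq> A \<and> S \<subseteq> B}"
  have step: "(\<phi> ` A, \<phi> ` B) \<in> ?R (\<phi> ` S)" if "(A, B) \<in> flag_step S" for A B S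
  proof -
    have "card (\<phi> ` A - \<phi> ` B) = card (A - B)" for A B
      using inj by (simp add: image_set_diff[symmetric] card_image inj_on_subset)
    then show ?thesis
      using that unfolding flag_step_def adjacent_flags_def flag_iff by auto
  qed
  have *: "(\<phi> ` A, \<phi> ` B) \<in> (?R (\<phi> ` S))\<^sup>*" if "(A, B) \<in> (flag_step S)\<^sup>*" for A B S
    using that
  proof induction
    case (step B C)
    then show ?case
      using \<open>\<And>A B S. (A, B) \<in> flag_step S \<Longrightarrow> (\<phi> ` A, \<phi> ` B) \<in> ?R (\<phi> ` S)\<close>
      by (meson rtrancl.rtrancl_into_rtrancl)
  qed auto
  then show ?thesis
    unfolding strongly_flag_connected_def flag_iff
  proof clarify
    fix s s' d d' and a b a' b' :: "'p mod_ring"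
    let ?A = "std_flag s a b d" and ?B = "std_flag s' a' b' d'"
    show "(\<phi> ` ?A, \<phi> ` ?B) \<in> (?R (\<phi> ` ?A \<inter> \<phi> ` ?B))\<^sup>*"
      unfolding image_Int[OF inj, symmetric] by (rule *) (rule std_flags_strongly_connected)
  qed
qed

text \<open>The two intermediate cells are named in each rank: the ends of an edge, the two edges of
  a polygon at a vertex, the two polygons at an edge.\<close>

lemma diamond:
  assumes "cell_le x y" "cell_rank y = cell_rank x + 2"
  shows "card {z \<in> P. \<phi> x < z \<and> z < \<phi> y} = 2"
proof -
  have two: ?thesis if uv: "u \<noteq> v" "\<And>z. cell_le x z \<and> x \<noteq> z \<and> cell_le z y \<and> z \<noteq> y \<longleftrightarrow> z = u \<or> z = v"
    for u v
  proof -
    have "\<phi> x < \<phi> z \<and> \<phi> z < \<phi> y \<longleftrightarrow> z = u \<or> z = v" for z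
      using uv(2)[of z] by (auto simp: less)
    then have "{z \<in> P. \<phi> x < z \<and> z < \<phi> y} = \<phi> ` {u, v}"
      unfolding range[symmetric] by (auto simp del: image_insert)
    then show ?thesis
      using uv(1) by simp
  qed
  show ?thesis
  proof (cases x)
    case Least
    then obtain i j where y: "y = Edge i j"
      using assms by (cases y) auto
    show ?thesis
    proof (rule two)
      fix z
      show "cell_le x z \<and> x \<noteq> z \<and> cell_le z y \<and> z \<noteq> y \<longleftrightarrow> z = Vert True i \<or> z = Vert False j"
        unfolding Least y by (cases z) (auto split: if_splits)
    qed auto
  next
    case (Vert s a)
    then obtain k where y: "y = Face k"
      using assms by (cases y) auto
    show ?thesis
    proof (rule two)
      fix z
      \<comment> \<open>On \<open>Face k\<close> the edges at index \<open>a\<close> end at the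
        indices \<open>b\<close> with k = a + b or k = a + b + 1.\<close>
      show "cell_le x z \<and> x \<noteq> z \<and> cell_le z y \<and> z \<noteq> y \<longleftrightarrow>
          z = edge_at s a (k - a) \<or> z = edge_at s a (k - a - 1)"
        unfolding Vert y by (cases z) (auto simp: edge_at_def algebra_simps split: if_splits)
    qed (auto simp: edge_at_def)
  next
    case (Edge i j)
    then have y: "y = Greatest"
      using assms by (cases y) auto
    show ?thesis
    proof (rule two)
      fix z
      show "cell_le x z \<and> x \<noteq> z \<and> cell_le z y \<and> z \<noteq> y \<longleftrightarrow>
          z = Face (i + j) \<or> z = Face (i + j + 1)"
        unfolding Edge y by (cases z) auto
    qed auto
  qed (use assms in \<open>cases y; auto\<close>)+
qed

lemma abstract_polytope: "abstract_polytope 3 P"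
proof -
  have "\<exists>b\<in>P. \<forall>x\<in>P. b \<le> x"
    unfolding range[symmetric] using le[of Least] by (intro bexI[of _ "\<phi> Least"]) auto
  moreover have "cell_le x Greatest" for x :: "'p mod_ring cell"
    by (cases x) auto
  then have "\<exists>t\<in>P. \<forall>x\<in>P. x \<le> t"
    unfolding range[symmetric] using le[of _ Greatest] by (intro bexI[of _ "\<phi> Greatest"]) auto
  moreover have "card (\<phi> ` std_flag s a b d) = 5" for s a b d
    using inj by (subst card_image) (auto intro: inj_on_subset simp: std_flag_def edge_at_def)
  then have "\<forall>F. flag P F \<longrightarrow> finite F \<and> card F = 3 + 2"
    unfolding flag_iff by (auto simp: finite_std_flag)
  moreover have "\<forall>x\<in>P. \<forall>y\<in>P. x < y \<and> face_rank P y = face_rank P x + 2 \<longrightarrow>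
        card {z \<in> P. x < z \<and> z < y} = 2"
  proof clarify
    fix x' y'
    assume "x' \<in> P" "y' \<in> P" and xy: "x' < y'" "face_rank P y' = face_rank P x' + 2"
    then obtain x y where "x' = \<phi> x" "y' = \<phi> y"
      using range by auto
    then show "card {z \<in> P. x' < z \<and> z < y'} = 2"
      using diamond xy by (simp add: less)
  qed
  ultimately show ?thesis
    using strongly_flag_connected unfolding abstract_polytope_def by blast
qed

section \<open>Automorphisms and flag transitivity\<close>

lemma flag_transitive: "flag_transitive P"
proof -
  \<comment> \<open>\<open>rel\<close> relates flags carried to one another by automorphisms. It
    suffices to compose three families: the exchange of the sides corrects \<open>s\<close>,
    negation corrects \<open>d\<close>, and translations correct \<open>a\<close> and
    \<open>b\<close>.\<close>
  define rel where "rel = (\<lambda>A B. \<exists>f. poset_automorphism P f \<and> f ` \<phi> ` A = \<phi> ` B)"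
  have trans: "rel A C" if AB: "rel A B" and BC: "rel B C" for A B C
  proof -
    obtain f g where fg: "poset_automorphism P f" "f ` \<phi> ` A = \<phi> ` B"
        "poset_automorphism P g" "g ` \<phi> ` B = \<phi> ` C"
      using AB BC unfolding rel_def by (elim exE conjE)
    have "poset_automorphism P (g \<circ> f)"
      using fg(1,3) unfolding poset_automorphism_def
      by (auto simp: bij_betw_trans dest: bij_betwE)
    moreover have "(g \<circ> f) ` \<phi> ` A = \<phi> ` C"
      by (simp only: image_comp[symmetric] fg)
    ultimately show ?thesis
      unfolding rel_def by (intro exI conjI)
  qed
  have relI: "rel A B" if f: "bij f" "\<And>x y. cell_le (f x) (f y) \<longleftrightarrow> cell_le x y" "f ` A = B" for f A B
  proof -
    have inv: "inv_into UNIV \<phi> (\<phi> x) = x" for x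
      using inj by simp
    have "poset_automorphism P (\<phi> \<circ> f \<circ> inv_into UNIV \<phi>)"
      unfolding poset_automorphism_def
    proof
      have "bij_betw (inv_into UNIV \<phi>) P UNIV"
        using inj range by (metis bij_betw_def bij_betw_inv_into)
      moreover have "bij_betw \<phi> UNIV P"
        using inj range by (simp add: bij_betw_def)
      ultimately show "bij_betw (\<phi> \<circ> f \<circ> inv_into UNIV \<phi>) P P"
        using f(1) by (auto intro!: bij_betw_trans)
      show "\<forall>x\<in>P. \<forall>y\<in>P. ((\<phi> \<circ> f \<circ> inv_into UNIV \<phi>) x \<le> (\<phi> \<circ> f \<circ> inv_into UNIV \<phi>) y) = (x \<le> y)"
        unfolding range[symmetric] by (auto simp: inv le f(2))
    qed
    moreover have "(\<phi> \<circ> f \<circ> inv_into UNIV \<phi>) ` \<phi> ` A = \<phi> ` B"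
      using f(3) by (auto simp: image_image inv)
    ultimately show ?thesis
      unfolding rel_def by (intro exI conjI)
  qed
  have flip: "rel (std_flag s a b d) (std_flag (\<not> s) a b d)" for s and a b :: "'p mod_ring" and d
  proof (rule relI)
    let ?f = "\<lambda>x :: 'p mod_ring cell. case x of Vert s a \<Rightarrow> Vert (\<not> s) a | Edge i j \<Rightarrow> Edge j i | _ \<Rightarrow> x"
    have "?f (?f x) = x" for x
      by (cases x) auto
    then show "bij ?f"
      by (intro o_bij[of ?f]) auto
    show "cell_le (?f x) (?f y) \<longleftrightarrow> cell_le x y" for x y
      by (cases x; cases y) (auto simp: add.commute)
    show "?f ` std_flag s a b d = std_flag (\<not> s) a b d"
      by (auto simp: std_flag_def edge_at_def)
  qed
  \<comment> \<open>The map \<open>k \<mapsto> 1 - k\<close> sends i + j to (- i) + (- j) + 1, so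
    negation exchanges the first and second face of an edge; this is why \<open>d\<close>
    flips.\<close>
  have neg: "rel (std_flag s a b d) (std_flag s (- a) (- b) (\<not> d))" for s and a b :: "'p mod_ring" and d
  proof (rule relI)
    let ?f = "\<lambda>x :: 'p mod_ring cell. case x of Vert s a \<Rightarrow> Vert s (- a) | Edge i j \<Rightarrow> Edge (- i) (- j)
      | Face k \<Rightarrow> Face (1 - k) | _ \<Rightarrow> x"
    have "?f (?f x) = x" for x
      by (cases x) auto
    then show "bij ?f"
      by (intro o_bij[of ?f]) auto
    show "cell_le (?f x) (?f y) \<longleftrightarrow> cell_le x y" for x y
      by (cases x; cases y) (auto simp: algebra_simps)
    show "?f ` std_flag s a b d = std_flag s (- a) (- b) (\<not> d)"
      by (auto simp: std_flag_def edge_at_def)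
  qed
  have shift: "rel (std_flag s a b d) (std_flag s a' b' d)" for s and a b a' b' :: "'p mod_ring" and d
  proof -
    define f where "f = (\<lambda>i j (x :: 'p mod_ring cell). case x of
      Vert t c \<Rightarrow> Vert t (if t then c + i else c + j) | Edge k l \<Rightarrow> Edge (k + i) (l + j)
      | Face k \<Rightarrow> Face (k + i + j) | _ \<Rightarrow> x)"
    \<comment> \<open>Side \<open>True\<close> is translated by \<open>i\<close> and side
      \<open>False\<close> by \<open>j\<close>. Which of them must move \<open>a\<close> to
      \<open>a'\<close> depends on the side of the flag's vertex.\<close>
    define i j where "i = (if s then a' - a else b' - b)" and "j = (if s then b' - b else a' - a)"
    have "f (- i) (- j) (f i j x) = x" "f i j (f (- i) (- j) x) = x" for i j x
      by (cases x; simp add: f_def)+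
    then have "bij (f i j)"
      by (intro o_bij[of "f (- i) (- j)"]) auto
    moreover have "cell_le (f i j x) (f i j y) \<longleftrightarrow> cell_le x y" for x y
      by (cases x; cases y) (auto simp: f_def algebra_simps)
    moreover have "f i j ` std_flag s a b d = std_flag s a' b' d"
      by (auto simp: f_def i_def j_def std_flag_def edge_at_def)
    ultimately show ?thesis
      by (rule relI)
  qed
  have "rel (std_flag s a b d) (std_flag s' a' b' d')" for s a b d s' a' b' d'
  proof -
    have "rel (std_flag s a b d) (std_flag s' a b d)"
      using flip[of s a b d] shift[of s a b d a b] by (cases "s' = s") auto
    moreover have "rel (std_flag s' a b d) (std_flag s' a' b' d')"
      using trans[OF neg[of s' a b d] shift[of s' _ _ _ a' b']] shift[of s' a b d a' b']
      by (cases "d' = d") auto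
    ultimately show ?thesis
      by (rule trans)
  qed
  then show ?thesis
    unfolding flag_transitive_def flag_iff rel_def by (auto simp del: image_insert)
qed

lemma regular_polytope: "regular_polytope 3 P"
  unfolding regular_polytope_def using abstract_polytope flag_transitive by blast

section \<open>The polygons, the vertex valency and the Schlaefli symbol\<close>

lemma vertices_of_edge:
  "{x \<in> faces P 0. x \<le> \<phi> (Edge i j)} = {\<phi> (Vert True i), \<phi> (Vert False j)}"
  by (auto simp: faces_0 le image_iff split: if_splits)

lemma is_ngon_face: "is_ngon P (2 * CARD('p)) (\<phi> (Face k))"
  unfolding is_ngon_def
proof (intro conjI exI)
  \<comment> \<open>The boundary of the polygon \<open>k\<close> runs \<open>A\<^sub>t\<close>,
    \<open>B\<close> with index k - 1 - t, then \<open>A\<close> with index t + 1. The index sums of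
    its edges alternate between k - 1 and k, the two values for which \<open>k\<close> is a face of
    the edge.\<close>
  let ?v = "interleave (\<lambda>t. \<phi> (Vert True t)) (\<lambda>t. \<phi> (Vert False (k - 1 - t)))"
  let ?e = "interleave (\<lambda>t. \<phi> (Edge t (k - 1 - t))) (\<lambda>t. \<phi> (Edge (t + 1) (k - 1 - t)))"
  show "2 \<le> 2 * CARD('p)"
    by simp
  show "inj_on ?v {..<2 * CARD('p)}"
    by (rule inj_on_interleave) (auto intro!: injI)
  show "inj_on ?e {..<2 * CARD('p)}"
    by (rule inj_on_interleave) (auto intro!: injI)
  show "?v ` {..<2 * CARD('p)} = {x \<in> faces P 0. x \<le> \<phi> (Face k)}"
    unfolding image_interleave
  proof (intro equalityI subsetI)
    fix x
    assume "x \<in> {x \<in> faces P 0. x \<le> \<phi> (Face k)}"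
    then obtain s a where x: "x = \<phi> (Vert s a)"
      by (auto simp: faces_0)
    show "x \<in> range (\<lambda>t. \<phi> (Vert True t)) \<union> range (\<lambda>t. \<phi> (Vert False (k - 1 - t)))"
      by (cases s) (auto simp: x intro: image_eqI[of _ _ "k - 1 - a"])
  qed (auto simp: faces_0 le)
  show "?e ` {..<2 * CARD('p)} = {x \<in> faces P 1. x \<le> \<phi> (Face k)}"
    unfolding image_interleave
  proof (intro equalityI subsetI)
    fix x
    assume "x \<in> {x \<in> faces P 1. x \<le> \<phi> (Face k)}"
    then obtain i j where x: "x = \<phi> (Edge i j)" and k: "k = i + j \<or> k = i + j + 1"
      by (auto simp: faces_1 le)
    from k show "x \<in> range (\<lambda>t. \<phi> (Edge t (k - 1 - t))) \<union> range (\<lambda>t. \<phi> (Edge (t + 1) (k - 1 - t)))"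
    proof
      assume "k = i + j"
      then show ?thesis
        by (intro UnI2 image_eqI[of _ _ "i - 1"]) (auto simp: x)
    next
      assume "k = i + j + 1"
      then show ?thesis
        by (intro UnI1 image_eqI[of _ _ i]) (auto simp: x)
    qed
  qed (auto simp: faces_1 le)
  show "\<forall>i<2 * CARD('p). {x \<in> faces P 0. x \<le> ?e i} = {?v i, ?v (Suc i mod (2 * CARD('p)))}"
  proof (intro allI impI)
    fix i
    assume "i < 2 * CARD('p)"
    note next_vertex = interleave_Suc_mod[OF this]
    show "{x \<in> faces P 0. x \<le> ?e i} = {?v i, ?v (Suc i mod (2 * CARD('p)))}"
      unfolding next_vertex by (cases "even i") (simp_all add: interleave_def vertices_of_edge insert_commute)
  qed
qed

lemma card_edges_at_vertex: "card {e \<in> faces P 1. \<phi> (Vert s a) \<le> e} = CARD('p)"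
proof -
  have "{e \<in> faces P 1. \<phi> (Vert s a) \<le> e} = range (\<lambda>b. \<phi> (edge_at s a b))"
    by (auto simp: faces_1 le image_iff edge_at_def split: if_splits)
  then show ?thesis
    by (simp add: card_image inj_def edge_at_def)
qed

lemma has_schlafli_symbol: "has_schlafli_symbol P (2 * CARD('p)) CARD('p)"
  unfolding has_schlafli_symbol_def
  using is_ngon_face card_edges_at_vertex by (auto simp: faces_0 faces_2)

end

subsection \<open>The triangulated surface\<close>

text \<open>The common shape of all vertex links: the closed walk f 0, g 0, f 1, g 1, ... of length
  2p. The length is at least 3 because p > 1.\<close>

lemma is_circle_interleave:
  fixes f g :: "'p::prime_card mod_ring \<Rightarrow> 'v"
  assumes "inj f" "inj g" "range f \<inter> range g = {}"
    and V: "V = range f \<union> range g"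
    and E: "E = {{f t, g t} | t. True} \<union> {{g t, f (t + 1)} | t. True}"
  shows "is_circle V E"
  unfolding is_circle_def
proof (intro exI conjI)
  let ?c = "interleave f g"
  have p: "CARD('p) > 1"
    using prime_card[where 'a = 'p] by (rule prime_gt_1_nat)
  then show "3 \<le> 2 * CARD('p)"
    by simp
  show "inj_on ?c {..<2 * CARD('p)}"
    using assms(1-3) by (rule inj_on_interleave)
  show "V = ?c ` {..<2 * CARD('p)}"
    unfolding image_interleave V ..
  have even: "{?c (2 * n), ?c (Suc (2 * n) mod (2 * CARD('p)))} = {f (of_nat n), g (of_nat n)}"
    and odd: "{?c (Suc (2 * n)), ?c (Suc (Suc (2 * n)) mod (2 * CARD('p)))} = {g (of_nat n), f (of_nat n + 1)}"
    if "n < CARD('p)" for n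
    using that interleave_Suc_mod[of "2 * n", where 'p = 'p and f = f and g = g]
      interleave_Suc_mod[of "Suc (2 * n)", where 'p = 'p and f = f and g = g] by auto
  show "E = {{?c i, ?c (Suc i mod (2 * CARD('p)))} | i. i < 2 * CARD('p)}"
  proof (intro equalityI subsetI)
    fix e assume "e \<in> E"
    then obtain t where e: "e = {f t, g t} \<or> e = {g t, f (t + 1)}"
      unfolding E by blast
    obtain n where n: "n < CARD('p)" "t = of_nat n"
      using surj_of_nat_mod_ring by blast
    from e show "e \<in> {{?c i, ?c (Suc i mod (2 * CARD('p)))} | i. i < 2 * CARD('p)}"
    proof
      assume "e = {f t, g t}"
      then show ?thesis
        using even[OF n(1)] n by (intro CollectI exI[of _ "2 * n"]) auto
    next
      assume "e = {g t, f (t + 1)}"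
      then show ?thesis
        using odd[OF n(1)] n by (intro CollectI exI[of _ "Suc (2 * n)"]) auto
    qed
  next
    fix e assume "e \<in> {{?c i, ?c (Suc i mod (2 * CARD('p)))} | i. i < 2 * CARD('p)}"
    then obtain i where i: "e = {?c i, ?c (Suc i mod (2 * CARD('p)))}" "i < 2 * CARD('p)"
      by blast
    show "e \<in> E"
      unfolding E i(1) interleave_Suc_mod[OF i(2)] by (cases "even i") (auto simp: interleave_def)
  qed
qed

lemma subset_triple_cases:
  assumes "r \<subseteq> {x, y, z}"
  shows "r = {} \<or> r = {x} \<or> r = {y} \<or> r = {z} \<or> r = {x, y} \<or> r = {x, z} \<or> r = {y, z} \<or> r = {x, y, z}"
proof -
  have "r \<in> Pow {x, y, z}"
    using assms by simp
  then show ?thesis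
    by (auto simp: Pow_insert)
qed

lemma Collect_range: "{f v | v. \<exists>k. v = g k} = range (\<lambda>k. f (g k))"
  by auto

lemma Collect_range2: "{f v | v. \<exists>i j. v = g i j} = range (\<lambda>(i, j). f (g i j))"
  by (auto simp: image_def)

section \<open>Connected components of graphs\<close>

lemma graph_component_refl: "v \<in> graph_component E v"
  by (simp add: graph_component_def)

lemma graph_component_step:
  "w \<in> graph_component E v \<Longrightarrow> {w, u} \<in> E \<Longrightarrow> u \<in> graph_component E v"
  by (auto simp: graph_component_def intro: rtrancl_into_rtrancl)

lemma graph_component_closed:
  assumes "\<And>w u. w \<in> S \<Longrightarrow> {w, u} \<in> E \<Longrightarrow> u \<in> S" "v \<in> S"
  shows "graph_component E v \<subseteq> S"
proof
  fix w assume "w \<in> graph_component E v"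
  then have "(v, w) \<in> {(a, b). {a, b} \<in> E}\<^sup>*"
    by (simp add: graph_component_def)
  then show "w \<in> S"
    by induction (use assms in auto)
qed

datatype 'i corner = Corner bool 'i | Centre 'i

text \<open>
  \<open>Corner True i\<close>, \<open>Corner False j\<close> and \<open>Centre k\<close> stand for \<open>A\<^sub>i\<close>, \<open>B\<^sub>j\<close> and \<open>C\<^sub>k\<close>.
\<close>

definition incident :: "'i::comm_ring_1 \<Rightarrow> 'i \<Rightarrow> 'i \<Rightarrow> bool" where
  "incident i j k \<longleftrightarrow> k = i + j \<or> k = i + j + 1"

lemma incident_commute: "incident i j k \<longleftrightarrow> incident j i k"
  by (simp add: incident_def add.commute)

lemma incident_ex1: "\<exists>j. incident i j k"
  by (rule exI[of _ "k - i"]) (simp add: incident_def)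

lemma incident_ex2: "\<exists>i. incident i j k"
  by (rule exI[of _ "k - j"]) (simp add: incident_def)

lemma range_corner: "(UNIV :: 'i corner set) = case_prod Corner ` UNIV \<union> range Centre"
proof -
  have "x \<in> case_prod Corner ` UNIV \<union> range Centre" for x :: "'i corner"
    by (cases x) auto
  then show ?thesis
    by blast
qed

text \<open>The shape to which every component of Y(G) will be brought. The two families of
  triangles are the two orientations A B C and B A C; forgetting the orientation leaves the relation
  \<open>incident\<close>.\<close>

locale tripartite_surface =
  fixes K :: "'v complex2" and h :: "'p::prime_card mod_ring corner \<Rightarrow> 'v"
  assumes inj: "inj h"
    and vertices: "vertices K = range h"
    and edges: "edges K = {{h (Corner True i), h (Corner False j)} | i j. True} \<union>
          {{h (Corner s i), h (Centre k)} | s i k. True}"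
    and triangles: "triangles K =
          {(h (Corner True i), h (Corner False j), h (Centre (i + j))) | i j. True} \<union>
          {(h (Corner False j), h (Corner True i), h (Centre (i + j + 1))) | i j. True}"
begin

section \<open>Simplices of the tripartite surface\<close>

lemma eq_iff [simp]: "h x = h y \<longleftrightarrow> x = y"
  using inj by (auto dest: injD)

text \<open>The two orientations merge into \<open>incident\<close>, which is symmetric in its first
  two arguments. The side \<open>s\<close> is free so that the links of the \<open>A\<^sub>i\<close>
  and of the \<open>B\<^sub>j\<close> are computed together.\<close>

lemma tri_sets:
  "tri_set ` triangles K = {{h (Corner s i), h (Corner (\<not> s) j), h (Centre k)} | i j k. incident i j k}"
    (is "_ = ?R s")
proof -
  have "?R True \<subseteq> tri_set ` triangles K"
  proof clarify
    fix i j k :: "'p mod_ring"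
    assume "incident i j k"
    then show "{h (Corner True i), h (Corner (\<not> True) j), h (Centre k)} \<in> tri_set ` triangles K"
      unfolding incident_def
    proof
      assume "k = i + j"
      then show ?thesis
        by (intro image_eqI[of _ _ "(h (Corner True i), h (Corner False j), h (Centre (i + j)))"])
           (auto simp: triangles)
    next
      assume "k = i + j + 1"
      then show ?thesis
        by (intro image_eqI[of _ _ "(h (Corner False j), h (Corner True i), h (Centre (i + j + 1)))"])
           (auto simp: triangles)
    qed
  qed
  moreover have "tri_set ` triangles K \<subseteq> ?R True"
  proof
    fix e assume "e \<in> tri_set ` triangles K"
    then consider i j where "e = {h (Corner True i), h (Corner False j), h (Centre (i + j))}"
      | i j where "e = {h (Corner False j), h (Corner True i), h (Centre (i + j + 1))}"
      unfolding triangles by auto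
    then show "e \<in> ?R True"
    proof cases
      case (1 i j)
      then show ?thesis
        by (intro CollectI exI[of _ i] exI[of _ j] exI[of _ "i + j"]) (simp add: incident_def)
    next
      case (2 i j)
      then show ?thesis
        by (intro CollectI exI[of _ i] exI[of _ j] exI[of _ "i + j + 1"])
           (simp add: incident_def insert_commute)
    qed
  qed
  moreover have "?R s \<subseteq> ?R (\<not> s)" for s
  proof clarify
    fix i j k :: "'p mod_ring"
    assume "incident i j k"
    then show "\<exists>i' j' k'. {h (Corner s i), h (Corner (\<not> s) j), h (Centre k)} =
        {h (Corner (\<not> s) i'), h (Corner (\<not> \<not> s) j'), h (Centre k')} \<and> incident i' j' k'"
      by (intro exI[of _ j] exI[of _ i] exI[of _ k]) (simp add: incident_commute insert_commute)
  qed
  from this[of True] this[of False] have "?R True = ?R False"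
    by simp
  ultimately show ?thesis
    by (cases s) (simp_all only: subset_antisym)
qed

lemma edge_cases:
  assumes "{a, b} \<in> edges K"
  obtains s i j where "a = h (Corner s i)" "b = h (Corner (\<not> s) j)"
  | s i k where "a = h (Corner s i)" "b = h (Centre k)"
  | s i k where "a = h (Centre k)" "b = h (Corner s i)"
proof -
  consider i j where "{a, b} = {h (Corner True i), h (Corner False j)}"
    | s i k where "{a, b} = {h (Corner s i), h (Centre k)}"
    using assms unfolding edges by blast
  then show thesis
  proof cases
    case (1 i j)
    then show thesis
      using that(1)[of True i j] that(1)[of False j i] by (auto simp: doubleton_eq_iff)
  next
    case (2 s i k)
    then show thesis
      using that(2)[of s i k] that(3)[of k s i] by (auto simp: doubleton_eq_iff)
  qed
qed

lemma edge_Corner: "{h (Corner s i), h (Corner (\<not> s) j)} \<in> edges K"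
  by (cases s) (auto simp: edges insert_commute)

lemma edge_Centre: "{h (Corner s i), h (Centre k)} \<in> edges K" "{h (Centre k), h (Corner s i)} \<in> edges K"
proof -
  show "{h (Corner s i), h (Centre k)} \<in> edges K"
    unfolding edges by blast
  then show "{h (Centre k), h (Corner s i)} \<in> edges K"
    by (simp add: insert_commute)
qed

lemma edge_Corner_Corner [simp]: "{h (Corner s i), h (Corner t j)} \<in> edges K \<longleftrightarrow> t = (\<not> s)"
  using edge_Corner by (auto elim: edge_cases)

lemma edge_Centre_Centre [simp]: "{h (Centre k), h (Centre l)} \<notin> edges K"
  by (auto elim: edge_cases)

lemma vertex_cases:
  assumes "v \<in> vertices K"
  obtains s i where "v = h (Corner s i)" | k where "v = h (Centre k)"
  using assms unfolding vertices by (metis corner.exhaust rangeE)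

lemma mem_closed_star_Centre:
  "r \<in> closed_star K (h (Centre k)) \<longleftrightarrow>
     r \<noteq> {} \<and> (\<exists>i j. incident i j k \<and> r \<subseteq> {h (Corner True i), h (Corner False j), h (Centre k)})"
proof -
  have "r \<in> closed_star K (h (Centre k)) \<longleftrightarrow>
      r \<noteq> {} \<and> (\<exists>i j k'. incident i j k' \<and>
        h (Centre k) \<in> {h (Corner True i), h (Corner (\<not> True) j), h (Centre k')} \<and>
        r \<subseteq> {h (Corner True i), h (Corner (\<not> True) j), h (Centre k')})"
    unfolding closed_star_def closed_simplex_def tri_sets[of True] by blast
  then show ?thesis
    by simp
qed

text \<open>Every vertex and every edge lies in a triangle, so the simplices are the nonempty
  subsets of triangles. This is the form in which they compare with closed stars.\<close>

lemma mem_simplices: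
  "r \<in> simplices K \<longleftrightarrow>
     r \<noteq> {} \<and> (\<exists>i j k. incident i j k \<and> r \<subseteq> {h (Corner True i), h (Corner False j), h (Centre k)})"
  (is "_ \<longleftrightarrow> ?R")
proof
  assume "r \<in> simplices K"
  then consider v where "v \<in> vertices K" "r = {v}" | "r \<in> edges K" | "r \<in> tri_set ` triangles K"
    unfolding simplices_def by blast
  then show ?R
  proof cases
    case 1
    from this(1) show ?thesis
    proof (cases rule: vertex_cases)
      case (1 s i)
      then show ?thesis
        using \<open>r = {v}\<close> incident_ex1[of i 0] incident_ex2[of i 0] by (cases s) auto
    next
      case (2 k)
      then show ?thesis
        using \<open>r = {v}\<close> incident_ex1[of 0 k] by auto
    qed
  next
    case 2
    then consider i j where "r = {h (Corner True i), h (Corner False j)}"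
      | s i k where "r = {h (Corner s i), h (Centre k)}"
      unfolding edges by blast
    then show ?thesis
    proof cases
      case (1 i j)
      then show ?thesis
        by (auto simp: incident_def)
    next
      case (2 s i k)
      then show ?thesis
        using incident_ex1[of i k] incident_ex2[of i k] by (cases s) auto
    qed
  next
    case 3
    then show ?thesis
      unfolding tri_sets[of True] by auto
  qed
next
  assume ?R
  then obtain i j k where ijk: "r \<noteq> {}" "incident i j k"
      "r \<subseteq> {h (Corner True i), h (Corner False j), h (Centre k)}"
    by blast
  have "{h c} \<in> simplices K" for c
    by (auto simp: simplices_def vertices)
  moreover have "{h (Corner True i), h (Corner False j)} \<in> simplices K"
      "{h (Corner s i'), h (Centre k)} \<in> simplices K" for s i'
    by (auto simp: simplices_def edges)
  moreover have "{h (Corner True i), h (Corner False j), h (Centre k)} \<in> tri_set ` triangles K"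
    unfolding tri_sets[of True] using ijk(2) by auto
  then have "{h (Corner True i), h (Corner False j), h (Centre k)} \<in> simplices K"
    by (simp add: simplices_def)
  ultimately show "r \<in> simplices K"
    using subset_triple_cases[OF ijk(3)] ijk(1) by (elim disjE) simp_all
qed

section \<open>Vertex links\<close>

lemma link_vertices_Corner:
  "link_vertices K (h (Corner s i)) = range (\<lambda>j. h (Corner (\<not> s) j)) \<union> range (\<lambda>k. h (Centre k))"
proof (intro equalityI subsetI)
  fix w assume "w \<in> link_vertices K (h (Corner s i))"
  then have "{h (Corner s i), w} \<in> edges K"
    by (simp add: link_vertices_def)
  then show "w \<in> range (\<lambda>j. h (Corner (\<not> s) j)) \<union> range (\<lambda>k. h (Centre k))"
    by (cases rule: edge_cases) auto
next
  fix w assume "w \<in> range (\<lambda>j. h (Corner (\<not> s) j)) \<union> range (\<lambda>k. h (Centre k))"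
  then show "w \<in> link_vertices K (h (Corner s i))"
    using edge_Centre edge_Corner by (auto simp: link_vertices_def)
qed

lemma link_vertices_Centre:
  "link_vertices K (h (Centre k)) = range (\<lambda>j. h (Corner True j)) \<union> range (\<lambda>k. h (Corner False k))"
proof (intro equalityI subsetI)
  fix w assume "w \<in> link_vertices K (h (Centre k))"
  then have "{h (Centre k), w} \<in> edges K"
    by (simp add: link_vertices_def)
  then obtain s i where "w = h (Corner s i)"
    by (auto elim: edge_cases)
  then show "w \<in> range (\<lambda>j. h (Corner True j)) \<union> range (\<lambda>k. h (Corner False k))"
    by (cases s) auto
next
  fix w assume "w \<in> range (\<lambda>j. h (Corner True j)) \<union> range (\<lambda>k. h (Corner False k))"
  then show "w \<in> link_vertices K (h (Centre k))"
    using edge_Centre by (auto simp: link_vertices_def)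
qed

lemma link_edges_Corner:
  "link_edges K (h (Corner s i)) = {{h (Corner (\<not> s) j), h (Centre k)} | j k. incident i j k}"
proof -
  have "link_edges K (h (Corner s i)) =
      {{h (Corner s i'), h (Corner (\<not> s) j), h (Centre k)} - {h (Corner s i)} | i' j k.
        incident i' j k \<and> h (Corner s i) \<in> {h (Corner s i'), h (Corner (\<not> s) j), h (Centre k)}}"
    unfolding link_edges_def tri_sets[of s] by blast
  also have "\<dots> = {{h (Corner s i'), h (Corner (\<not> s) j), h (Centre k)} - {h (Corner s i)} | i' j k.
        incident i' j k \<and> i = i'}"
    by simp
  also have "\<dots> = {{h (Corner s i), h (Corner (\<not> s) j), h (Centre k)} - {h (Corner s i)} | j k. incident i j k}"
    by blast
  finally show ?thesis
    by simp
qed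

lemma link_edges_Centre:
  "link_edges K (h (Centre k)) = {{h (Corner True i), h (Corner False j)} | i j. incident i j k}"
proof -
  have "link_edges K (h (Centre k)) =
      {{h (Corner True i), h (Corner False j), h (Centre k')} - {h (Centre k)} | i j k'.
        incident i j k' \<and> h (Centre k) \<in> {h (Corner True i), h (Corner False j), h (Centre k')}}"
    unfolding link_edges_def tri_sets[of True] by (simp only: not_True_eq_False) blast
  also have "\<dots> = {{h (Corner True i), h (Corner False j), h (Centre k')} - {h (Centre k)} | i j k'.
        incident i j k' \<and> k = k'}"
    by simp
  also have "\<dots> = {{h (Corner True i), h (Corner False j), h (Centre k)} - {h (Centre k)} | i j. incident i j k}"
    by blast
  moreover have "{h (Corner True i), h (Corner False j), h (Centre k)} - {h (Centre k)} =
      {h (Corner True i), h (Corner False j)}" for i j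
    by auto
  ultimately show ?thesis
    by simp
qed

lemma is_circle_link:
  assumes "v \<in> vertices K"
  shows "is_circle (link_vertices K v) (link_edges K v)"
  using assms
proof (cases rule: vertex_cases)
  case (1 s i)
  show ?thesis
  proof (rule is_circle_interleave)
    \<comment> \<open>Around a corner with index \<open>i\<close>, the centre i + t + 1 is incident
      with the opposite corners t and t + 1, so it separates them on the circle.\<close>
    let ?f = "\<lambda>t. h (Corner (\<not> s) t)" and ?g = "\<lambda>t. h (Centre (i + t + 1))"
    show "inj ?f" "inj ?g"
      by (auto intro: injI)
    have "k \<in> range (\<lambda>t. i + t + 1)" for k
      by (rule image_eqI[of _ _ "k - i - 1"]) auto
    then have "range (\<lambda>k. h (Centre k)) = range ?g"
      by (auto simp: image_iff)
    then show "link_vertices K v = range ?f \<union> range ?g"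
      unfolding 1 link_vertices_Corner by simp
    show "link_edges K v = {{?f t, ?g t} | t. True} \<union> {{?g t, ?f (t + 1)} | t. True}"
    proof (intro equalityI subsetI)
      fix e assume "e \<in> link_edges K v"
      then obtain j k where e: "e = {?f j, h (Centre k)}" "k = i + j \<or> k = i + j + 1"
        unfolding 1 link_edges_Corner incident_def by blast
      from e(2) show "e \<in> {{?f t, ?g t} | t. True} \<union> {{?g t, ?f (t + 1)} | t. True}"
      proof
        assume "k = i + j"
        then show ?thesis
          unfolding e(1) by (intro UnI2 CollectI exI[of _ "j - 1"]) auto
      next
        assume "k = i + j + 1"
        then show ?thesis
          unfolding e(1) by (intro UnI1 CollectI exI[of _ j]) auto
      qed
    next
      fix e assume "e \<in> {{?f t, ?g t} | t. True} \<union> {{?g t, ?f (t + 1)} | t. True}"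
      then obtain t where "e = {?f t, ?g t} \<or> e = {?f (t + 1), ?g t}"
        by blast
      moreover have "incident i t (i + t + 1)" "incident i (t + 1) (i + t + 1)"
        by (auto simp: incident_def)
      ultimately show "e \<in> link_edges K v"
        unfolding 1 link_edges_Corner by blast
    qed
  qed auto
next
  case (2 k)
  show ?thesis
  proof (rule is_circle_interleave)
    \<comment> \<open>Around the centre \<open>k\<close>, the corners occur in the same order as
      along the polygon \<open>Face k\<close>.\<close>
    let ?f = "\<lambda>t. h (Corner True t)" and ?g = "\<lambda>t. h (Corner False (k - 1 - t))"
    show "inj ?f" "inj ?g"
      by (auto intro: injI)
    have "\<exists>t. j = k - 1 - t" for j
      by (rule exI[of _ "k - 1 - j"]) simp
    then have "range (\<lambda>k. h (Corner False k)) = range ?g"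
      by (auto simp: image_iff)
    then show "link_vertices K v = range ?f \<union> range ?g"
      unfolding 2 link_vertices_Centre by simp
    show "link_edges K v = {{?f t, ?g t} | t. True} \<union> {{?g t, ?f (t + 1)} | t. True}"
    proof (intro equalityI subsetI)
      fix e assume "e \<in> link_edges K v"
      then obtain i j where e: "e = {?f i, h (Corner False j)}" "k = i + j \<or> k = i + j + 1"
        unfolding 2 link_edges_Centre incident_def by blast
      from e(2) show "e \<in> {{?f t, ?g t} | t. True} \<union> {{?g t, ?f (t + 1)} | t. True}"
      proof
        assume "k = i + j"
        then show ?thesis
          unfolding e(1) by (intro UnI2 CollectI exI[of _ "i - 1"]) auto
      next
        assume "k = i + j + 1"
        then show ?thesis
          unfolding e(1) by (intro UnI1 CollectI exI[of _ i]) auto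
      qed
    next
      fix e assume "e \<in> {{?f t, ?g t} | t. True} \<union> {{?g t, ?f (t + 1)} | t. True}"
      then obtain t where "e = {?f t, ?g t} \<or> e = {?f (t + 1), ?g t}"
        by blast
      moreover have "incident t (k - 1 - t) k" "incident (t + 1) (k - 1 - t) k"
        by (auto simp: incident_def)
      ultimately show "e \<in> link_edges K v"
        unfolding 2 link_edges_Centre by blast
    qed
  qed auto
qed

text \<open>Every corner is joined to every centre: one corner reaches all centres, and these reach
  all corners.\<close>

lemma connected:
  assumes "v \<in> vertices K" "w \<in> vertices K"
  shows "w \<in> graph_component (edges K) v"
proof -
  have step: "{a, b} \<in> edges K \<Longrightarrow> a \<in> graph_component (edges K) v \<Longrightarrow> b \<in> graph_component (edges K) v"
    for a b
    by (rule graph_component_step)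
  obtain s i where si: "h (Corner s i) \<in> graph_component (edges K) v"
    using assms(1)
  proof (cases rule: vertex_cases)
    case (1 s i)
    then show ?thesis
      using that graph_component_refl by metis
  next
    case (2 k)
    then show ?thesis
      using that[of True 0] step[OF edge_Centre(2)] graph_component_refl by metis
  qed
  then have centre: "h (Centre k) \<in> graph_component (edges K) v" for k
    by (rule step[OF edge_Centre(1)])
  then have "h (Corner s i) \<in> graph_component (edges K) v" for s i
    by (rule step[OF edge_Centre(2)])
  with centre show ?thesis
    using vertex_cases[OF assms(2)] by metis
qed

text \<open>The direction of the edge selects one of the two orientation families. Within a family
  two indices determine the third, because the centre is i + j or i + j + 1 respectively.\<close>

lemma unique_triangle:
  assumes "{a, b} \<in> edges K"
  shows "\<exists>!t. t \<in> triangles K \<and> (a, b) \<in> tri_boundary t"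
  using assms
proof (cases rule: edge_cases)
  case (1 s i j)
  show ?thesis
  proof (cases s)
    case True
    show ?thesis
      by (rule ex1I[of _ "(h (Corner True i), h (Corner False j), h (Centre (i + j)))"])
         (use 1 True in \<open>auto simp: triangles\<close>)
  next
    case False
    show ?thesis
      by (rule ex1I[of _ "(h (Corner False i), h (Corner True j), h (Centre (j + i + 1)))"])
         (use 1 False in \<open>auto simp: triangles\<close>)
  qed
next
  case (2 s i k)
  show ?thesis
  proof (cases s)
    case True
    have *: "\<exists>j. k = j + (1 + i)"
      by (rule exI[of _ "k - i - 1"]) simp
    show ?thesis
      by (rule ex1I[of _ "(h (Corner False (k - i - 1)), h (Corner True i), h (Centre k))"])
         (use 2 True * in \<open>auto simp: triangles field_simps\<close>)
  next
    case False
    have *: "\<exists>j. k = j + i"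
      by (rule exI[of _ "k - i"]) simp
    show ?thesis
      by (rule ex1I[of _ "(h (Corner True (k - i)), h (Corner False i), h (Centre k))"])
         (use 2 False * in \<open>auto simp: triangles field_simps\<close>)
  qed
next
  case (3 s i k)
  show ?thesis
  proof (cases s)
    case True
    have *: "\<exists>j. k = j + i"
      by (rule exI[of _ "k - i"]) simp
    show ?thesis
      by (rule ex1I[of _ "(h (Corner True i), h (Corner False (k - i)), h (Centre k))"])
         (use 3 True * in \<open>auto simp: triangles field_simps\<close>)
  next
    case False
    have *: "\<exists>j. k = j + (1 + i)"
      by (rule exI[of _ "k - i - 1"]) simp
    show ?thesis
      by (rule ex1I[of _ "(h (Corner False i), h (Corner True (k - i - 1)), h (Centre k))"])
         (use 3 False * in \<open>auto simp: triangles field_simps\<close>)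
  qed
qed

lemma closed_oriented_surface: "closed_oriented_surface K"
  unfolding closed_oriented_surface_def
proof (intro conjI)
  show "finite (vertices K)"
    unfolding vertices by (subst range_corner) auto
  show "vertices K \<noteq> {}"
    by (simp add: vertices)
  show "\<forall>e\<in>edges K. e \<subseteq> vertices K \<and> card e = 2"
    unfolding edges vertices by auto
  show "\<forall>t\<in>triangles K. tri_set t \<subseteq> vertices K \<and> card (tri_set t) = 3 \<and>
       (\<forall>e\<subseteq>tri_set t. card e = 2 \<longrightarrow> e \<in> edges K)"
  proof
    fix t assume "t \<in> triangles K"
    then have "tri_set t \<in> tri_set ` triangles K"
      by (rule imageI)
    then obtain i j k where t: "tri_set t = {h (Corner True i), h (Corner False j), h (Centre k)}"
      unfolding tri_sets[of True] by auto
    have "e \<in> edges K" if e: "e \<subseteq> tri_set t" "card e = 2" for e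
    proof -
      obtain x y where "e = {x, y}" "x \<noteq> y"
        using e(2) by (auto simp: card_2_iff)
      with e(1) show ?thesis
        unfolding t using edge_Centre by (auto simp: edge_Corner)
    qed
    then show "tri_set t \<subseteq> vertices K \<and> card (tri_set t) = 3 \<and>
       (\<forall>e\<subseteq>tri_set t. card e = 2 \<longrightarrow> e \<in> edges K)"
      unfolding t vertices by auto
  qed
  show "inj_on tri_set (triangles K)"
  proof (rule inj_onI)
    fix t u
    assume t: "t \<in> triangles K" and u: "u \<in> triangles K" and eq: "tri_set t = tri_set u"
    have *: "h (Corner s i) \<in> tri_set t \<longleftrightarrow> h (Corner s i) \<in> tri_set u"
       "h (Centre i) \<in> tri_set t \<longleftrightarrow> h (Centre i) \<in> tri_set u" for s i
      using eq by simp_all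
    obtain i j where ij: "t = (h (Corner True i), h (Corner False j), h (Centre (i + j))) \<or>
        t = (h (Corner False j), h (Corner True i), h (Centre (i + j + 1)))"
      using t unfolding triangles by blast
    obtain k l where kl: "u = (h (Corner True k), h (Corner False l), h (Centre (k + l))) \<or>
        u = (h (Corner False l), h (Corner True k), h (Centre (k + l + 1)))"
      using u unfolding triangles by blast
    \<comment> \<open>The corners of the simplex fix both indices; whether its centre is i + j or i
      + j + 1 then tells the orientation.\<close>
    have "k = i" "l = j"
      using *(1)[of True i] *(1)[of False j] ij kl by auto
    then show "t = u"
      using *(2)[of "i + j"] *(2)[of "i + j + 1"] ij kl by auto
  qed
  show "\<forall>v\<in>vertices K. \<forall>w\<in>vertices K. w \<in> graph_component (edges K) v"
    using connected by blast
  show "\<forall>v\<in>vertices K. is_circle (link_vertices K v) (link_edges K v)"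
    using is_circle_link by blast
  show "\<forall>a b. a \<noteq> b \<and> {a, b} \<in> edges K \<longrightarrow> (\<exists>!t. t \<in> triangles K \<and> (a, b) \<in> tri_boundary t)"
    using unique_triangle by blast
qed

section \<open>Euler characteristic and genus\<close>

lemma euler_characteristic: "euler_characteristic K = 3 * int CARD('p) - int CARD('p) ^ 2"
proof -
  have "card (vertices K) = 3 * CARD('p)"
  proof -
    have "card (vertices K) = card (UNIV :: 'p mod_ring corner set)"
      unfolding vertices using inj by (rule card_image)
    also have "\<dots> = card (case_prod Corner ` (UNIV :: (bool \<times> 'p mod_ring) set)) + card (range (Centre :: 'p mod_ring \<Rightarrow> _))"
      by (subst range_corner, rule card_Un_disjoint) auto
    also have "\<dots> = 3 * CARD('p)"
      by (subst (1 2) card_image) (auto intro: injI)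
    finally show ?thesis .
  qed
  moreover have "card (edges K) = 3 * CARD('p) ^ 2"
  proof -
    let ?f = "\<lambda>(i, j). {h (Corner True i), h (Corner False j)}"
    let ?g = "\<lambda>(s, i, k). {h (Corner s i), h (Centre k)}"
    have "edges K = range ?f \<union> range ?g"
      unfolding edges by (intro arg_cong2[where f = "(\<union>)"]) (auto simp: image_def)
    also have "card \<dots> = card (range ?f) + card (range ?g)"
      by (rule card_Un_disjoint) (auto simp: doubleton_eq_iff)
    also have "\<dots> = 3 * CARD('p) ^ 2"
      by (subst (1 2) card_image) (auto intro!: injI simp: doubleton_eq_iff power2_eq_square)
    finally show ?thesis .
  qed
  moreover have "card (triangles K) = 2 * CARD('p) ^ 2"
  proof -
    let ?f = "\<lambda>(i, j). (h (Corner True i), h (Corner False j), h (Centre (i + j)))"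
    let ?g = "\<lambda>(i, j). (h (Corner False j), h (Corner True i), h (Centre (i + j + 1)))"
    have inj_f: "inj ?f" and inj_g: "inj ?g"
      by (simp_all add: inj_def)
    have "triangles K = range ?f \<union> range ?g"
      unfolding triangles by (intro arg_cong2[where f = "(\<union>)"]) (auto simp: image_def)
    moreover have "range ?f \<inter> range ?g = {}"
      by (auto simp: disjoint_iff)
    ultimately have "card (triangles K) = card (range ?f) + card (range ?g)"
      by (simp add: card_Un_disjoint)
    also have "\<dots> = CARD('p mod_ring \<times> 'p mod_ring) + CARD('p mod_ring \<times> 'p mod_ring)"
      using inj_f inj_g by (simp only: card_image)
    also have "\<dots> = 2 * CARD('p) ^ 2"
      by (simp add: power2_eq_square)
    finally show ?thesis .
  qed
  ultimately show ?thesis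
    unfolding euler_characteristic_def by simp
qed

lemma closed_oriented_surface_of_genus:
  assumes "odd CARD('p)"
  shows "closed_oriented_surface_of_genus (CARD('p) * (CARD('p) - 3) div 2 + 1) K"
proof -
  have "CARD('p) \<noteq> 2" "CARD('p) \<noteq> 1" "CARD('p) > 0"
    using assms prime_card[where 'a = 'p] by (auto simp: prime_gt_0_nat)
  \<comment> \<open>The genus is obtained from 2 - 2g = 3p - p^2. The bound keeps the natural
    subtraction p - 3 from being truncated, and oddness makes the division by 2 exact.\<close>
  then have ge: "CARD('p) \<ge> 3"
    by linarith
  have "even (CARD('p) * (CARD('p) - 3))"
    using assms ge by simp
  then have "2 * (CARD('p) * (CARD('p) - 3) div 2) = CARD('p) * (CARD('p) - 3)"
    by simp
  then have "2 * int (CARD('p) * (CARD('p) - 3) div 2) = int CARD('p) * (int CARD('p) - 3)"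
    using ge by (metis of_nat_mult of_nat_numeral of_nat_diff)
  then show ?thesis
    unfolding closed_oriented_surface_of_genus_def
    using closed_oriented_surface euler_characteristic by (simp add: algebra_simps power2_eq_square)
qed

end

subsubsection \<open>The cells\<close>

locale tessellated_surface = tripartite_surface K h
  for K :: "'a vertexY complex2" and h :: "'p::prime_card mod_ring corner \<Rightarrow> 'a vertexY" +
  assumes type_Corner: "vertex_type (h (Corner s i)) = 1"
    and type_Centre: "vertex_type (h (Centre k)) = 2"
begin

text \<open>The realization of the abstract cells by which each component becomes an instance of
  \<open>cell_poset\<close>.\<close>

fun cell_set :: "'p mod_ring cell \<Rightarrow> 'a vertexY set set" where
  "cell_set Least = {}"
| "cell_set (Vert s i) = closed_simplex {h (Corner s i)}"
| "cell_set (Edge i j) = closed_simplex {h (Corner True i), h (Corner False j)}"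
| "cell_set (Face k) = closed_star K (h (Centre k))"
| "cell_set Greatest = simplices K"

lemma hat_vertices: "hat_vertices K = range (\<lambda>(s, i). cell_set (Vert s i))"
proof -
  have "v \<in> vertices K \<and> vertex_type v = 1 \<longleftrightarrow> (\<exists>s i. v = h (Corner s i))" for v
    unfolding vertices using type_Corner type_Centre by (auto simp: range_corner)
  then have "hat_vertices K = {closed_simplex {v} | v. \<exists>s i. v = h (Corner s i)}"
    unfolding hat_vertices_def by simp
  then show ?thesis
    unfolding Collect_range2 by simp
qed

lemma hat_edges: "hat_edges K = range (\<lambda>(i, j). cell_set (Edge i j))"
proof -
  have "e \<in> edges K \<and> (\<forall>v\<in>e. vertex_type v = 1) \<longleftrightarrow> (\<exists>i j. e = {h (Corner True i), h (Corner False j)})" for e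
    unfolding edges using type_Corner type_Centre by auto
  then have "hat_edges K = {closed_simplex e | e. \<exists>i j. e = {h (Corner True i), h (Corner False j)}}"
    unfolding hat_edges_def by simp
  then show ?thesis
    unfolding Collect_range2 by simp
qed

lemma hat_faces: "hat_faces K = range (\<lambda>k. cell_set (Face k))"
proof -
  have "v \<in> vertices K \<and> vertex_type v = 2 \<longleftrightarrow> (\<exists>k. v = h (Centre k))" for v
    unfolding vertices using type_Corner type_Centre by (auto simp: range_corner)
  then have "hat_faces K = {closed_star K v | v. \<exists>k. v = h (Centre k)}"
    unfolding hat_faces_def by simp
  then show ?thesis
    unfolding Collect_range by simp
qed

lemma hat_cells: "hat_cells K = cell_set ` {x. x \<noteq> Least \<and> x \<noteq> Greatest}"
proof -
  have "{x. x \<noteq> Least \<and> x \<noteq> Greatest} = range (\<lambda>(s, i). Vert s i) \<union> range (\<lambda>(i, j). Edge i j) \<union>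
      range (Face :: 'p mod_ring \<Rightarrow> _)"
  proof (intro equalityI subsetI)
    fix x :: "'p mod_ring cell"
    assume "x \<in> {x. x \<noteq> Least \<and> x \<noteq> Greatest}"
    then show "x \<in> range (\<lambda>(s, i). Vert s i) \<union> range (\<lambda>(i, j). Edge i j) \<union> range Face"
      by (cases x) auto
  qed auto
  then show ?thesis
    unfolding hat_cells_def hat_vertices hat_edges hat_faces
    by (simp add: image_Un image_image case_prod_unfold)
qed

lemma cell_set_mono: "cell_le x y \<Longrightarrow> cell_set x \<subseteq> cell_set y"
proof -
  assume le: "cell_le x y"
  have *: "\<exists>i j. incident i j k \<and> Corner s a \<in> {Corner True i, Corner False j}"
    "\<exists>i j k. incident i j k \<and> Corner s a \<in> {Corner True i, Corner False j}" for s a k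
    \<comment> \<open>Each corner lies in some triangle about each centre, so every vertex cell is
      contained in every polygon.\<close>
    using incident_ex1[of a k] incident_ex2[of a k] by (cases s; auto)+
  show ?thesis
  proof (cases x)
    case (Vert s a)
    then show ?thesis
      using le *(1)[of _ s a] *(2)[of s a]
      by (cases y) (auto simp: closed_simplex_def mem_closed_star_Centre mem_simplices split: if_splits, fastforce+)
  next
    case (Edge i j)
    have "incident i j (i + j)"
      by (simp add: incident_def)
    with Edge show ?thesis
      using le by (cases y) (auto simp: closed_simplex_def mem_closed_star_Centre mem_simplices incident_def, blast+)
  next
    case (Face k)
    then show ?thesis
      using le by (cases y) (auto simp: mem_closed_star_Centre mem_simplices)
  next
    case Greatest
    then show ?thesis
      using le by (cases y) auto
  qed auto
qed

text \<open>One simplex tests each inclusion: the vertex itself, the edge itself, or the centre of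
  the polygon.\<close>

lemma cell_set_le: "cell_set x \<subseteq> cell_set y \<Longrightarrow> cell_le x y"
proof -
  assume sub: "cell_set x \<subseteq> cell_set y"
  have vert: "{h (Corner s a)} \<in> cell_set z \<Longrightarrow> cell_le (Vert s a) z"
    and edge: "{h (Corner True i), h (Corner False j)} \<in> cell_set z \<Longrightarrow> cell_le (Edge i j) z"
    and face: "{h (Centre k)} \<in> cell_set z \<Longrightarrow> cell_le (Face k) z"
    for s a i j k z
    by (cases z; auto simp: closed_simplex_def mem_closed_star_Centre incident_def)+
  have centre: "{h (Centre k)} \<in> cell_set (Face k)" for k
    using incident_ex1[of 0 k] by (auto simp: mem_closed_star_Centre)
  show "cell_le x y"
  proof (cases x)
    case (Vert s a)
    then have "{h (Corner s a)} \<in> cell_set y"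
      using sub by (auto simp: closed_simplex_def)
    then show ?thesis
      unfolding Vert by (rule vert)
  next
    case (Edge i j)
    then have "{h (Corner True i), h (Corner False j)} \<in> cell_set y"
      using sub by (auto simp: closed_simplex_def)
    then show ?thesis
      unfolding Edge by (rule edge)
  next
    case (Face k)
    then have "{h (Centre k)} \<in> cell_set y"
      using sub centre[of k] by auto
    then show ?thesis
      unfolding Face by (rule face)
  next
    case Greatest
    have "{h (Centre k)} \<in> simplices K" for k
      using incident_ex1[of 0 k] by (auto simp: mem_simplices)
    then have "cell_le (Face k) y" for k
      using sub face[of k y] Greatest by auto
    \<comment> \<open>A single polygon contains only its own centre, so two different centres
      already force \<open>Greatest\<close>.\<close>
    from this[of 0] this[of 1] show ?thesis
      using Greatest by (cases y) auto
  qed auto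
qed

sublocale poset: cell_poset "hat_poset K" cell_set
proof
  show "range cell_set = hat_poset K"
  proof -
    have "(UNIV :: 'p mod_ring cell set) = {Least} \<union> {x. x \<noteq> Least \<and> x \<noteq> Greatest} \<union> {Greatest}"
      by auto
    then have "range cell_set = cell_set ` ({Least} \<union> {x. x \<noteq> Least \<and> x \<noteq> Greatest} \<union> {Greatest})"
      by simp
    then show ?thesis
      unfolding hat_poset_def hat_cells image_Un by simp
  qed
  show "cell_set x \<le> cell_set y \<longleftrightarrow> cell_le x y" for x y
    using cell_set_mono cell_set_le by blast
qed

section \<open>Cell counts, valency and the tessellation\<close>

lemma card_hat_faces: "card (hat_faces K) = CARD('p)"
  unfolding hat_faces by (subst card_image) (auto intro: injI simp del: cell_set.simps)

lemma card_hat_edges: "card (hat_edges K) = CARD('p) ^ 2"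
  unfolding hat_edges by (subst card_image) (auto intro: injI simp: power2_eq_square simp del: cell_set.simps)

lemma card_hat_vertices: "card (hat_vertices K) = 2 * CARD('p)"
  unfolding hat_vertices by (subst card_image) (auto intro: injI simp del: cell_set.simps)

lemma valency:
  assumes "v \<in> hat_vertices K"
  shows "valency K v = CARD('p)"
proof -
  obtain s a where "v = cell_set (Vert s a)"
    using assms hat_vertices by auto
  then show ?thesis
    unfolding valency_def hat_edges using poset.card_edges_at_vertex[of s a] by (simp add: poset.faces_1)
qed

lemma tessellates_with_ngons: "tessellates_with_ngons K (2 * CARD('p))"
  unfolding tessellates_with_ngons_def
proof (intro conjI ballI impI)
  fix f assume "f \<in> hat_faces K"
  then show "is_ngon (hat_poset K) (2 * CARD('p)) f"
    unfolding hat_faces using poset.is_ngon_face by auto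
next
  have "r \<in> \<Union> (hat_faces K) \<longleftrightarrow> r \<in> simplices K" for r
    unfolding hat_faces by (auto simp: mem_simplices mem_closed_star_Centre)
  then show "\<Union> (hat_faces K) = simplices K"
    by blast
next
  fix f f' assume "f \<in> hat_faces K" "f' \<in> hat_faces K" "f \<noteq> f'"
  then obtain k k' where f: "f = cell_set (Face k)" "f' = cell_set (Face k')" "k \<noteq> k'"
    unfolding hat_faces by auto
  show "f \<inter> f' \<subseteq> \<Union> (hat_vertices K \<union> hat_edges K)"
  proof
    fix r assume r: "r \<in> f \<inter> f'"
    then obtain i j where ij: "r \<noteq> {}" "r \<subseteq> {h (Corner True i), h (Corner False j), h (Centre k)}"
      by (auto simp: f mem_closed_star_Centre)
    \<comment> \<open>A simplex shared with the star of another centre avoids the centre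
      \<open>k\<close>, hence lies in the edge opposite to it in its triangle.\<close>
    have "h (Centre k) \<notin> r"
      using r f(3) by (auto simp: f mem_closed_star_Centre)
    with ij have "r \<in> cell_set (Edge i j)"
      by (auto simp: closed_simplex_def)
    then show "r \<in> \<Union> (hat_vertices K \<union> hat_edges K)"
      unfolding hat_edges by blast
  qed
qed

end

text \<open>Both surfaces realize the same abstract cells; one realization is composed with the
  inverse of the other.\<close>

lemma cell_isomorphic_models:
  assumes "tessellated_surface K (g :: 'p::prime_card mod_ring corner \<Rightarrow> 'a vertexY)"
    and "tessellated_surface L (h :: 'p mod_ring corner \<Rightarrow> 'a vertexY)"
  shows "cell_isomorphic K L"
proof -
  interpret K: tessellated_surface K g by fact
  interpret L: tessellated_surface L h by fact
  define \<phi> where "\<phi> = L.cell_set \<circ> inv_into UNIV K.cell_set"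
  have \<phi>: "\<phi> (K.cell_set x) = L.cell_set x" for x
    using K.poset.inj by (simp add: \<phi>_def)
  have "inj_on \<phi> (hat_cells K)"
    unfolding K.hat_cells by (auto intro!: inj_onI simp: \<phi>)
  moreover have "\<phi> ` hat_cells K = hat_cells L"
    unfolding K.hat_cells L.hat_cells by (simp add: image_image \<phi>)
  ultimately have "bij_betw \<phi> (hat_cells K) (hat_cells L)"
    by (simp add: bij_betw_def)
  moreover have "\<phi> ` hat_vertices K = hat_vertices L" "\<phi> ` hat_edges K = hat_edges L" "\<phi> ` hat_faces K = hat_faces L"
    unfolding K.hat_vertices L.hat_vertices K.hat_edges L.hat_edges K.hat_faces L.hat_faces
    by (simp_all add: image_image case_prod_unfold \<phi> del: L.cell_set.simps K.cell_set.simps)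
  moreover have "\<forall>x\<in>hat_cells K. \<forall>y\<in>hat_cells K. \<phi> x \<subseteq> \<phi> y \<longleftrightarrow> x \<subseteq> y"
    unfolding K.hat_cells by (auto simp: \<phi> K.poset.le L.poset.le)
  ultimately show ?thesis
    unfolding cell_isomorphic_def by blast
qed

subsection \<open>Central extensions by a prime field\<close>

lemma graph_component_mono: "E \<subseteq> E' \<Longrightarrow> graph_component E v \<subseteq> graph_component E' v"
  unfolding graph_component_def using rtrancl_mono[of "{(a, b). {a, b} \<in> E}" "{(a, b). {a, b} \<in> E'}"] by blast

text \<open>The path from \<open>f t\<close> through \<open>g (t + a)\<close> leads to
  \<open>f (t + (a - b))\<close>. The shift a - b is nonzero, so all of \<open>f\<close>, and with
  it all of \<open>g\<close>, is reached; \<open>closed\<close> prevents leaving these two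
  ranges.\<close>

lemma graph_component_zigzag:
  fixes f g :: "'p::prime_card mod_ring \<Rightarrow> 'v"
  assumes "a \<noteq> b" and edges: "\<And>t. {f t, g (t + a)} \<in> E" "\<And>t. {f t, g (t + b)} \<in> E"
    and closed: "\<And>e. e \<in> E \<Longrightarrow> e \<inter> (range f \<union> range g) \<noteq> {} \<Longrightarrow> e \<subseteq> range f \<union> range g"
    and x: "x \<in> range f \<union> range g"
  shows "graph_component E x = range f \<union> range g"
proof
  show "graph_component E x \<subseteq> range f \<union> range g"
  proof (rule graph_component_closed)
    fix w u
    assume "w \<in> range f \<union> range g" "{w, u} \<in> E"
    then show "u \<in> range f \<union> range g"
      using closed[of "{w, u}"] by blast
  qed (rule x)
  have step: "w \<in> graph_component E x \<Longrightarrow> {w, u} \<in> E \<or> {u, w} \<in> E \<Longrightarrow> u \<in> graph_component E x" for w u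
    using graph_component_step by (metis insert_commute)
  have edges': "{f (t - a), g t} \<in> E" "{f (t + (a - b)), g (t + a)} \<in> E" for t
    using edges(1)[of "t - a"] edges(2)[of "t + (a - b)"] by (simp_all add: algebra_simps)
  obtain t where "f t \<in> graph_component E x"
  proof -
    from x consider t where "x = f t" | t where "x = g t"
      by blast
    then show ?thesis
    proof cases
      case (1 t)
      then show ?thesis
        using that[of t] graph_component_refl[of x E] by simp
    next
      case (2 t)
      then show ?thesis
        using that[of "t - a"] step[of "g t" "f (t - a)"] edges'(1)[of t] graph_component_refl[of x E] by simp
    qed
  qed
  then have f: "f u \<in> graph_component E x" for u
  proof (rule mod_ring_shift_induct[of "a - b" "\<lambda>u. f u \<in> graph_component E x", rotated])
    fix t assume "f t \<in> graph_component E x"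
    then show "f (t + (a - b)) \<in> graph_component E x"
      using step edges(1) edges'(2) by metis
  qed (use assms(1) in auto)
  moreover have "g u \<in> graph_component E x" for u
    using f[of "u - a"] edges'(1)[of u] step by blast
  ultimately show "range f \<union> range g \<subseteq> graph_component E x"
    by blast
qed

lemma tri_set_image:
  "tri_set ` {(f v w c d, g v w c d, k v w c d) | v w c d. Q v w} =
    {{f v w c d, g v w c d, k v w c d} | v w c d. Q v w}"
proof (intro equalityI subsetI)
  fix s assume "s \<in> tri_set ` {(f v w c d, g v w c d, k v w c d) | v w c d. Q v w}"
  then obtain t where "s = tri_set t" "\<exists>v w c d. t = (f v w c d, g v w c d, k v w c d) \<and> Q v w"
    by (elim imageE CollectE)
  then show "s \<in> {{f v w c d, g v w c d, k v w c d} | v w c d. Q v w}"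
    by (metis (mono_tags, lifting) mem_Collect_eq tri_set.simps)
next
  fix s assume "s \<in> {{f v w c d, g v w c d, k v w c d} | v w c d. Q v w}"
  then obtain v w c d where "s = tri_set (f v w c d, g v w c d, k v w c d)" "Q v w"
    by auto
  then show "s \<in> tri_set ` {(f v w c d, g v w c d, k v w c d) | v w c d. Q v w}"
    by blast
qed

text \<open>The additive group \<open>'w\<close> extended centrally by the prime field, with the
  biadditive map \<open>\<beta>\<close> as cocycle. \<open>el v c\<close> is the lift of
  \<open>v\<close> with central coordinate \<open>c\<close>.\<close>

locale central_extension =
  fixes G :: "('g, 'm) monoid_scheme"
    and el :: "'w::ab_group_add \<Rightarrow> 'p::prime_card mod_ring \<Rightarrow> 'g"
    and \<beta> :: "'w \<Rightarrow> 'w \<Rightarrow> 'p mod_ring"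
  assumes carrier: "carrier G = {el v c | v c. True}"
    and el_eq [simp]: "el v c = el w d \<longleftrightarrow> v = w \<and> c = d"
    and mult: "el v c \<otimes>\<^bsub>G\<^esub> el w d = el (v + w) (c + d + \<beta> v w)"
    and add_left: "\<beta> (v + w) u = \<beta> v u + \<beta> w u"
    and add_right: "\<beta> u (v + w) = \<beta> u v + \<beta> u w"
begin

text \<open>Lifts of \<open>v\<close> and \<open>w\<close> do not commute. For \<open>U3\<close> the
  difference of the two sides is the determinant of the pair, so this is linear independence in the
  plane.\<close>

definition indep :: "'w \<Rightarrow> 'w \<Rightarrow> bool" where
  "indep v w \<longleftrightarrow> \<beta> v w \<noteq> \<beta> w v"

lemma indep_commute: "indep v w \<longleftrightarrow> indep w v"
  by (auto simp: indep_def)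

lemma indep_irrefl: "indep v w \<Longrightarrow> v \<noteq> w"
  by (auto simp: indep_def)

lemma indep_add [simp]: "indep v (v + w) \<longleftrightarrow> indep v w" "indep w (v + w) \<longleftrightarrow> indep v w"
  by (auto simp: indep_def add_left add_right)

lemma noncommuting_el: "noncommuting G (el v c) (el w d) \<longleftrightarrow> indep v w"
  by (auto simp: noncommuting_def carrier mult indep_def add.commute)

section \<open>The complex X(G) in coordinates\<close>

definition X1 :: "'w \<Rightarrow> 'p mod_ring \<Rightarrow> 'g \<times> nat" where
  "X1 v c = (el v c, 1)"

definition X2 :: "'w \<Rightarrow> 'p mod_ring \<Rightarrow> 'g \<times> nat" where
  "X2 v c = (el v c, 2)"

lemma X_eq [simp]: "X1 v c = X1 w d \<longleftrightarrow> v = w \<and> c = d" "X2 v c = X2 w d \<longleftrightarrow> v = w \<and> c = d"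
  "X1 v c \<noteq> X2 w d" "X2 w d \<noteq> X1 v c"
  by (auto simp: X1_def X2_def)

lemma edges_X: "edges (X G) = {{X1 v c, X1 w d} | v w c d. indep v w} \<union> {{X1 v c, X2 w d} | v w c d. indep v w}"
proof -
  have *: "noncommuting G x y \<longleftrightarrow> (\<exists>v w c d. x = el v c \<and> y = el w d \<and> indep v w)" for x y
    using noncommuting_el by (auto simp: noncommuting_def carrier)
  show ?thesis
    unfolding X_def * X1_def X2_def by (simp, blast)
qed

lemma triangles_X:
  "triangles (X G) = {(X1 v c, X1 w d, X2 (v + w) (c + d + \<beta> v w)) | v w c d. indep v w}"
proof -
  have *: "noncommuting G x y \<longleftrightarrow> (\<exists>v w c d. x = el v c \<and> y = el w d \<and> indep v w)" for x y
    using noncommuting_el by (auto simp: noncommuting_def carrier)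
  show ?thesis
    unfolding X_def * X1_def X2_def mult[symmetric] by (simp, blast)
qed

text \<open>A type 2 neighbour over \<open>u\<close> is written over \<open>v + w\<close> with w = u
  - v, since the pair \<open>v\<close>, \<open>w\<close> is what names the link circle.\<close>

lemma edge_X_cases:
  assumes "{a, b} \<in> edges (X G)"
  obtains v w c d where "a = X1 v c" "b = X1 w d" "indep v w"
  | v w c d where "a = X1 v c" "b = X2 (v + w) d" "indep v w"
  | v w c d where "a = X2 (v + w) d" "b = X1 v c" "indep v w"
proof -
  consider v w c d where "{a, b} = {X1 v c, X1 w d}" "indep v w"
    | v u c d where "{a, b} = {X1 v c, X2 u d}" "indep v u"
    using assms unfolding edges_X by blast
  then show thesis
  proof cases
    case (1 v w c d)
    then show thesis
      using that(1)[of v c w d] that(1)[of w d v c] indep_commute by (auto simp: doubleton_eq_iff)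
  next
    case (2 v u c d)
    then have "indep v (u - v)"
      using indep_add(1)[of v "u - v"] by simp
    with 2 show thesis
      using that(2)[of v c "u - v" d] that(3)[of v "u - v" d c] by (auto simp: doubleton_eq_iff)
  qed
qed

lemma edges_X_I:
  assumes "indep v w"
  shows "{X1 v c, X1 w d} \<in> edges (X G)" "{X1 v c, X2 (v + w) d} \<in> edges (X G)"
    "{X2 (v + w) d, X1 v c} \<in> edges (X G)"
proof -
  show "{X1 v c, X1 w d} \<in> edges (X G)" "{X1 v c, X2 (v + w) d} \<in> edges (X G)"
    using assms indep_add(1)[of v w] unfolding edges_X by blast+
  then show "{X2 (v + w) d, X1 v c} \<in> edges (X G)"
    by (simp add: insert_commute)
qed

section \<open>Links in X(G)\<close>

lemma tri_sets_X:
  "tri_set ` triangles (X G) = {{X1 v c, X1 w d, X2 (v + w) (c + d + \<beta> v w)} | v w c d. indep v w}"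
  unfolding triangles_X tri_set_image ..

text \<open>A type 1 vertex can be the first or the second factor of the product at the type 2
  vertex; the two orders contribute \<open>\<beta> v w\<close> and
  \<open>\<beta> w v\<close>.\<close>

lemma link_edges_X1:
  "link_edges (X G) (X1 v c) =
     {{X1 w d, X2 (v + w) (c + d + \<beta> v w)} | w d. indep v w} \<union>
     {{X1 w d, X2 (v + w) (c + d + \<beta> w v)} | w d. indep v w}" (is "?L = ?R")
proof (intro equalityI subsetI)
  fix e assume "e \<in> ?L"
  then obtain v' w c' d where e: "e = {X1 v' c', X1 w d, X2 (v' + w) (c' + d + \<beta> v' w)} - {X1 v c}"
    "X1 v c \<in> {X1 v' c', X1 w d, X2 (v' + w) (c' + d + \<beta> v' w)}" "indep v' w"
    unfolding link_edges_def tri_sets_X by blast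
  from e(2) consider "v' = v" "c' = c" | "w = v" "d = c"
    by auto
  then show "e \<in> ?R"
  proof cases
    case 1
    moreover from this have "w \<noteq> v"
      using e(3) indep_irrefl by blast
    ultimately have "e = {X1 w d, X2 (v + w) (c + d + \<beta> v w)}"
      using e(1) by auto
    then show ?thesis
      using e(3) 1 by blast
  next
    case 2
    moreover from this have "v' \<noteq> v"
      using e(3) indep_irrefl by blast
    ultimately have "e = {X1 v' c', X2 (v + v') (c + c' + \<beta> v' v)}"
      using e(1) by (auto simp: add.commute)
    moreover have "indep v v'"
      using e(3) 2 indep_commute by blast
    ultimately show ?thesis
      by blast
  qed
next
  fix e assume "e \<in> ?R"
  then consider w d where "e = {X1 w d, X2 (v + w) (c + d + \<beta> v w)}" "indep v w"
    | w d where "e = {X1 w d, X2 (w + v) (d + c + \<beta> w v)}" "indep w v"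
    using indep_commute by (auto simp: add.commute)
  then show "e \<in> ?L"
  proof cases
    case (1 w d)
    then have "{X1 v c, X1 w d, X2 (v + w) (c + d + \<beta> v w)} \<in> tri_set ` triangles (X G)"
      unfolding tri_sets_X by blast
    moreover have "w \<noteq> v"
      using 1(2) indep_irrefl by blast
    then have "e = {X1 v c, X1 w d, X2 (v + w) (c + d + \<beta> v w)} - {X1 v c}"
      using 1(1) by auto
    ultimately show ?thesis
      unfolding link_edges_def by blast
  next
    case (2 w d)
    then have "{X1 w d, X1 v c, X2 (w + v) (d + c + \<beta> w v)} \<in> tri_set ` triangles (X G)"
      unfolding tri_sets_X by blast
    moreover have "w \<noteq> v"
      using 2(2) indep_irrefl by blast
    then have "e = {X1 w d, X1 v c, X2 (w + v) (d + c + \<beta> w v)} - {X1 v c}"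
      using 2(1) by auto
    ultimately show ?thesis
      unfolding link_edges_def by blast
  qed
qed

lemma link_edges_X2:
  "link_edges (X G) (X2 u k) =
     {{X1 v c, X1 w d} | v w c d. indep v w \<and> v + w = u \<and> c + d + \<beta> v w = k}" (is "?L = ?R")
proof (intro equalityI subsetI)
  fix e assume "e \<in> ?L"
  then obtain v w c d where e: "e = {X1 v c, X1 w d, X2 (v + w) (c + d + \<beta> v w)} - {X2 u k}"
    "X2 u k \<in> {X1 v c, X1 w d, X2 (v + w) (c + d + \<beta> v w)}" "indep v w"
    unfolding link_edges_def tri_sets_X by blast
  then have uk: "u = v + w" "k = c + d + \<beta> v w"
    by auto
  then have "e = {X1 v c, X1 w d}"
    using e(1) by auto
  then show "e \<in> ?R"
    using uk e(3) by blast
next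
  fix e assume "e \<in> ?R"
  then obtain v w c d where e: "e = {X1 v c, X1 w d}" "indep v w" "u = v + w" "k = c + d + \<beta> v w"
    by blast
  have "{X1 v c, X1 w d, X2 u k} \<in> tri_set ` triangles (X G)"
    unfolding tri_sets_X e(3,4) using e(2) by blast
  moreover have "e = {X1 v c, X1 w d, X2 u k} - {X2 u k}"
    using e(1) by auto
  ultimately show "e \<in> ?L"
    unfolding link_edges_def by blast
qed

definition circle1 :: "'w \<Rightarrow> 'w \<Rightarrow> ('g \<times> nat) set" where
  "circle1 v w = range (X1 w) \<union> range (X2 (v + w))"

definition circle2 :: "'w \<Rightarrow> 'w \<Rightarrow> ('g \<times> nat) set" where
  "circle2 v w = range (X1 v) \<union> range (X1 w)"

text \<open>In the link, the lifts of \<open>w\<close> meet those of \<open>v + w\<close> at two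
  offsets, one for each order of multiplication. The offsets differ exactly because the lifts do not
  commute, so the zigzag covers the whole circle.\<close>

lemma link_component_X1:
  assumes "indep v w" "x \<in> circle1 v w"
  shows "graph_component (link_edges (X G) (X1 v c)) x = circle1 v w"
  unfolding circle1_def
proof (rule graph_component_zigzag)
  show "c + \<beta> v w \<noteq> c + \<beta> w v"
    using assms(1) by (simp add: indep_def)
  show "{X1 w t, X2 (v + w) (t + (c + \<beta> v w))} \<in> link_edges (X G) (X1 v c)"
    and "{X1 w t, X2 (v + w) (t + (c + \<beta> w v))} \<in> link_edges (X G) (X1 v c)" for t
  proof -
    have eq: "t + (c + b) = c + t + b" for b
      by simp
    show "{X1 w t, X2 (v + w) (t + (c + \<beta> v w))} \<in> link_edges (X G) (X1 v c)"
      and "{X1 w t, X2 (v + w) (t + (c + \<beta> w v))} \<in> link_edges (X G) (X1 v c)"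
      unfolding link_edges_X1 eq using assms(1) by blast+
  qed
  show "e \<subseteq> range (X1 w) \<union> range (X2 (v + w))"
    if e: "e \<in> link_edges (X G) (X1 v c)" "e \<inter> (range (X1 w) \<union> range (X2 (v + w))) \<noteq> {}" for e
  proof -
    obtain w' d k where "e = {X1 w' d, X2 (v + w') k}"
      using e(1) unfolding link_edges_X1 by blast
    moreover from this have "w' = w"
      using e(2) by auto
    ultimately show ?thesis
      by auto
  qed
  show "x \<in> range (X1 w) \<union> range (X2 (v + w))"
    using assms(2) by (simp add: circle1_def)
qed

lemma link_component_X2:
  assumes "indep v w" "x \<in> circle2 v w"
  shows "graph_component (link_edges (X G) (X2 (v + w) k)) x = circle2 v w"
proof -
  \<comment> \<open>Adjacent vertices satisfy a condition on the sum of their coordinates; the sign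
    turns it into the constant offset required by \<open>graph_component_zigzag\<close>.\<close>
  let ?g = "\<lambda>t. X1 w (- t)"
  have "X1 w t \<in> range ?g" for t
    by (rule image_eqI[of _ _ "- t"]) simp_all
  then have range: "range ?g = range (X1 w)"
    by auto
  have "graph_component (link_edges (X G) (X2 (v + w) k)) x = range (X1 v) \<union> range ?g"
  proof (rule graph_component_zigzag)
    show "\<beta> v w - k \<noteq> \<beta> w v - k"
      using assms(1) by (simp add: indep_def)
    show "{X1 v t, X1 w (- (t + (\<beta> v w - k)))} \<in> link_edges (X G) (X2 (v + w) k)" for t
    proof -
      have "t + (- (t + (\<beta> v w - k))) + \<beta> v w = k"
        by simp
      then show ?thesis
        unfolding link_edges_X2 using assms(1) by blast
    qed
    show "{X1 v t, X1 w (- (t + (\<beta> w v - k)))} \<in> link_edges (X G) (X2 (v + w) k)" for t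
    proof -
      have "- (t + (\<beta> w v - k)) + t + \<beta> w v = k" "w + v = v + w"
        by (simp_all add: add.commute)
      then have "{X1 w (- (t + (\<beta> w v - k))), X1 v t} \<in> link_edges (X G) (X2 (v + w) k)"
        unfolding link_edges_X2 using assms(1) indep_commute by blast
      then show ?thesis
        by (simp add: insert_commute)
    qed
    show "e \<subseteq> range (X1 v) \<union> range ?g"
      if e': "e \<in> link_edges (X G) (X2 (v + w) k)" "e \<inter> (range (X1 v) \<union> range ?g) \<noteq> {}" for e
    proof -
      obtain v' w' c d where e: "e = {X1 v' c, X1 w' d}" "v' + w' = v + w"
        using e'(1) unfolding link_edges_X2 by blast
      then have "v' = v \<or> v' = w \<or> w' = v \<or> w' = w"
        using e'(2) unfolding range by auto
      \<comment> \<open>Both ends of a link edge lie over vectors with sum \<open>v + w\<close>, so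
        one of them determines the other.\<close>
      then have "v' = v \<and> w' = w \<or> v' = w \<and> w' = v"
        using e(2) by (metis add.commute add_left_cancel)
      then show ?thesis
        unfolding range using e(1) by auto
    qed
    show "x \<in> range (X1 v) \<union> range ?g"
      unfolding range using assms(2) by (simp add: circle2_def)
  qed
  then show ?thesis
    unfolding range circle2_def .
qed

subsubsection \<open>The desingularization\<close>

definition Y1 :: "'w \<Rightarrow> 'w \<Rightarrow> 'p mod_ring \<Rightarrow> 'g vertexY" where
  "Y1 v w c = (X1 v c, circle1 v w)"

definition Y2 :: "'w \<Rightarrow> 'w \<Rightarrow> 'p mod_ring \<Rightarrow> 'g vertexY" where
  "Y2 v w c = (X2 (v + w) c, circle2 v w)"

lemma puncture_X1:
  assumes "indep v w"
  shows "puncture (X G) (X1 v c) (X1 w d) = Y1 v w c" "puncture (X G) (X1 v c) (X2 (v + w) d) = Y1 v w c"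
proof -
  have "X1 w d \<in> circle1 v w" "X2 (v + w) d \<in> circle1 v w"
    by (simp_all add: circle1_def)
  then show "puncture (X G) (X1 v c) (X1 w d) = Y1 v w c" "puncture (X G) (X1 v c) (X2 (v + w) d) = Y1 v w c"
    unfolding puncture_def Y1_def using assms by (simp_all only: link_component_X1)
qed

lemma puncture_X2:
  assumes "indep v w"
  shows "puncture (X G) (X2 (v + w) c) (X1 v d) = Y2 v w c"
proof -
  have "X1 v d \<in> circle2 v w"
    by (simp add: circle2_def)
  then show ?thesis
    unfolding puncture_def Y2_def using assms by (simp only: link_component_X2)
qed

lemma Y2_commute: "Y2 v w c = Y2 w v c"
  by (auto simp: Y2_def circle2_def add.commute)

text \<open>Testing which sample vertices \<open>X1 u 0\<close> lie on a circle recovers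
  \<open>w\<close> from \<open>circle1 v w\<close>, but only the unordered pair from
  \<open>circle2 v w\<close>.\<close>

lemma Y_eq: "Y1 v w c = Y1 v' w' c' \<longleftrightarrow> v = v' \<and> w = w' \<and> c = c'"
  "Y2 v w c = Y2 v' w' c' \<longleftrightarrow> (v = v' \<and> w = w' \<or> v = w' \<and> w = v') \<and> c = c'"
  "Y1 v w c \<noteq> Y2 v' w' c'" "Y2 v' w' c' \<noteq> Y1 v w c"
proof -
  have "X1 u 0 \<in> circle1 v w \<longleftrightarrow> u = w" for u v w
    by (auto simp: circle1_def)
  then show "Y1 v w c = Y1 v' w' c' \<longleftrightarrow> v = v' \<and> w = w' \<and> c = c'"
    unfolding Y1_def by (metis X_eq(1) prod.inject)
  have "X1 u 0 \<in> circle2 v w \<longleftrightarrow> u = v \<or> u = w" for u v w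
    by (auto simp: circle2_def)
  then have "v = v' \<or> v = w'" if "circle2 v w = circle2 v' w'"
    using that by metis
  then show "Y2 v w c = Y2 v' w' c' \<longleftrightarrow> (v = v' \<and> w = w' \<or> v = w' \<and> w = v') \<and> c = c'"
    unfolding Y2_def by (auto simp: add.commute circle2_def)
qed (auto simp: Y1_def Y2_def)

section \<open>Simplices of Y(G)\<close>

lemma vertices_Y: "vertices (Y G) = {Y1 v w c | v w c. indep v w} \<union> {Y2 v w c | v w c. indep v w}"
    (is "_ = ?R")
proof -
  have "vertices (Y G) = {puncture (X G) a b | a b. a \<in> vertices (X G) \<and> b \<noteq> a \<and> {a, b} \<in> edges (X G)}"
    unfolding Y_def desingularization_def link_vertices_def by auto
  also have "\<dots> = ?R"
  proof (intro equalityI subsetI)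
    fix x assume "x \<in> {puncture (X G) a b | a b. a \<in> vertices (X G) \<and> b \<noteq> a \<and> {a, b} \<in> edges (X G)}"
    then obtain a b where x: "x = puncture (X G) a b" and ab: "{a, b} \<in> edges (X G)"
      by blast
    from ab show "x \<in> ?R"
    proof (cases rule: edge_X_cases)
      case (1 v w c d)
      then have "x = Y1 v w c"
        using x puncture_X1(1) by simp
      then show ?thesis
        using 1 by blast
    next
      case (2 v w c d)
      then have "x = Y1 v w c"
        using x puncture_X1(2) by simp
      then show ?thesis
        using 2 by blast
    next
      case (3 v w c d)
      then have "x = Y2 v w d"
        using x puncture_X2 by simp
      then show ?thesis
        using 3 by blast
    qed
  next
    have vertex: "X1 v c \<in> vertices (X G)" "X2 (v + w) c \<in> vertices (X G)" if "indep v w" for v w c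
    proof -
      \<comment> \<open>The lift \<open>el w 0\<close> is a witness that \<open>el v c\<close> is
        not central.\<close>
      have "el v c \<in> carrier G - group_center G" if "indep v w" for v w c
        using that noncommuting_el[of v c w 0] by (auto simp: noncommuting_def group_center_def)
      from this[of v w] this[of "v + w" v] show "X1 v c \<in> vertices (X G)" "X2 (v + w) c \<in> vertices (X G)"
        using that indep_commute[of "v + w" v] by (auto simp: X_def X1_def X2_def)
    qed
    fix x assume "x \<in> ?R"
    then consider v w c where "x = Y1 v w c" "indep v w" | v w c where "x = Y2 v w c" "indep v w"
      by blast
    then show "x \<in> {puncture (X G) a b | a b. a \<in> vertices (X G) \<and> b \<noteq> a \<and> {a, b} \<in> edges (X G)}"
    proof cases
      case (1 v w c)
      then show ?thesis
        using vertex edges_X_I(2)[of v w c 0] puncture_X1(2)[of v w c 0]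
        by (intro CollectI exI[of _ "X1 v c"] exI[of _ "X2 (v + w) 0"]) simp
    next
      case (2 v w c)
      then show ?thesis
        using vertex edges_X_I(3)[of v w c 0] puncture_X2[of v w c 0]
        by (intro CollectI exI[of _ "X2 (v + w) c"] exI[of _ "X1 v 0"]) simp
    qed
  qed
  finally show ?thesis .
qed

lemma edges_Y:
  "edges (Y G) = {{Y1 v w c, Y1 w v d} | v w c d. indep v w} \<union> {{Y1 v w c, Y2 v w d} | v w c d. indep v w}"
    (is "_ = ?R")
proof -
  have "edges (Y G) = {{puncture (X G) a b, puncture (X G) b a} | a b. a \<noteq> b \<and> {a, b} \<in> edges (X G)}"
    unfolding Y_def desingularization_def by simp
  also have "\<dots> = ?R"
  proof (intro equalityI subsetI)
    fix x assume "x \<in> {{puncture (X G) a b, puncture (X G) b a} | a b. a \<noteq> b \<and> {a, b} \<in> edges (X G)}"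
    then obtain a b where x: "x = {puncture (X G) a b, puncture (X G) b a}" and ab: "{a, b} \<in> edges (X G)"
      by blast
    from ab show "x \<in> ?R"
    proof (cases rule: edge_X_cases)
      case (1 v w c d)
      then have "x = {Y1 v w c, Y1 w v d}"
        using puncture_X1(1)[of v w] puncture_X1(1)[of w v] indep_commute x by simp
      then show ?thesis
        using 1 by blast
    next
      case (2 v w c d)
      then have "x = {Y1 v w c, Y2 v w d}"
        using puncture_X1(2) puncture_X2 x by simp
      then show ?thesis
        using 2 by blast
    next
      case (3 v w c d)
      then have "x = {Y1 v w c, Y2 v w d}"
        using puncture_X1(2) puncture_X2 x by (simp add: insert_commute)
      then show ?thesis
        using 3 by blast
    qed
  next
    fix x assume "x \<in> ?R"
    then consider v w c d where "x = {Y1 v w c, Y1 w v d}" "indep v w" "indep w v"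
      | v w c d where "x = {Y1 v w c, Y2 v w d}" "indep v w"
      using indep_commute by blast
    then show "x \<in> {{puncture (X G) a b, puncture (X G) b a} | a b. a \<noteq> b \<and> {a, b} \<in> edges (X G)}"
    proof cases
      case (1 v w c d)
      then show ?thesis
        using edges_X_I(1)[of v w c d] indep_irrefl[of v w]
        by (intro CollectI exI[of _ "X1 v c"] exI[of _ "X1 w d"]) (simp add: puncture_X1)
    next
      case (2 v w c d)
      then show ?thesis
        using edges_X_I(2)[of v w c d]
        by (intro CollectI exI[of _ "X1 v c"] exI[of _ "X2 (v + w) d"]) (simp add: puncture_X1 puncture_X2)
    qed
  qed
  finally show ?thesis .
qed

lemma triangles_Y:
  "triangles (Y G) = {(Y1 v w c, Y1 w v d, Y2 v w (c + d + \<beta> v w)) | v w c d. indep v w}"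
proof -
  have "triangles (Y G) = {(puncture (X G) a b, puncture (X G) b c, puncture (X G) c a) | a b c.
      (a, b, c) \<in> triangles (X G)}"
    unfolding Y_def desingularization_def by simp
  also have "\<dots> = {(puncture (X G) (X1 v c) (X1 w d), puncture (X G) (X1 w d) (X2 (v + w) (c + d + \<beta> v w)),
      puncture (X G) (X2 (v + w) (c + d + \<beta> v w)) (X1 v c)) | v w c d. indep v w}"
    unfolding triangles_X by blast
  also have "\<dots> = {(Y1 v w c, Y1 w v d, Y2 v w (c + d + \<beta> v w)) | v w c d. indep v w}"
  proof -
    \<comment> \<open>Seen from a lift of \<open>w\<close>, the type 2 vertex lies over w + v, hence
      on the circle of the reversed pair.\<close>
    have "puncture (X G) (X1 w d) (X2 (v + w) k) = Y1 w v d" if "indep v w" for v w d k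
      using puncture_X1(2)[of w v d k] that indep_commute by (simp add: add.commute)
    then show ?thesis
      by (auto simp: puncture_X1 puncture_X2 cong: conj_cong) (blast, metis puncture_X1(1) puncture_X2)
  qed
  finally show ?thesis .
qed

text \<open>
  The commutator of lifts of \<open>v\<close> and \<open>w\<close>, up to sign. In units of it, the second face at an edge
  comes right after the first one.
\<close>

definition comm :: "'w \<Rightarrow> 'w \<Rightarrow> 'p mod_ring" where
  "comm v w = \<beta> w v - \<beta> v w"

text \<open>The offset \<open>\<beta> v w\<close> places the product of the lifts with indices i and
  j at centre i + j. In the opposite order \<open>\<beta> w v\<close> exceeds it by one unit
  \<open>comm v w\<close>, which gives centre i + j + 1.\<close>

fun corner_map :: "'w \<Rightarrow> 'w \<Rightarrow> 'p mod_ring corner \<Rightarrow> 'g vertexY" where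
  "corner_map v w (Corner s i) = (if s then Y1 v w else Y1 w v) (comm v w * i)"
| "corner_map v w (Centre k) = Y2 v w (comm v w * k + \<beta> v w)"

definition component_at :: "'w \<Rightarrow> 'w \<Rightarrow> 'g vertexY complex2" where
  "component_at v w = (let C = range (corner_map v w) in
     \<lparr>vertices = C, edges = {e \<in> edges (Y G). e \<subseteq> C}, triangles = {t \<in> triangles (Y G). tri_set t \<subseteq> C}\<rparr>)"

section \<open>The components of Y(G) as tripartite surfaces\<close>

lemma corner_map_surj:
  assumes "indep v w"
  obtains i j k where "c = comm v w * i" "c = comm v w * j" "c = comm v w * k + \<beta> v w"
proof -
  have "comm v w \<noteq> 0"
    using assms by (auto simp: comm_def indep_def)
  then show thesis
    using that[of "c / comm v w" "c / comm v w" "(c - \<beta> v w) / comm v w"] by simp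
qed

lemma Y1_in_range: "indep v w \<Longrightarrow> Y1 v' w' c \<in> range (corner_map v w) \<longleftrightarrow> v' = v \<and> w' = w \<or> v' = w \<and> w' = v"
proof -
  assume "indep v w"
  then obtain i where i: "c = comm v w * i"
    using corner_map_surj by metis
  have "Y1 v w c = corner_map v w (Corner True i)" "Y1 w v c = corner_map v w (Corner False i)"
    by (simp_all add: i)
  then have "Y1 v w c \<in> range (corner_map v w)" "Y1 w v c \<in> range (corner_map v w)"
    by (metis rangeI)+
  moreover have "v' = v \<and> w' = w \<or> v' = w \<and> w' = v" if "Y1 v' w' c = corner_map v w x" for x
    using that by (cases x) (auto simp: Y_eq split: if_splits)
  ultimately show ?thesis
    by blast
qed

lemma Y2_in_range: "indep v w \<Longrightarrow> Y2 v' w' c \<in> range (corner_map v w) \<longleftrightarrow> v' = v \<and> w' = w \<or> v' = w \<and> w' = v"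
proof -
  assume "indep v w"
  then obtain k where k: "c = comm v w * k + \<beta> v w"
    using corner_map_surj by metis
  have "Y2 v w c = corner_map v w (Centre k)" "Y2 w v c = corner_map v w (Centre k)"
    by (simp_all add: k Y2_commute)
  then have "Y2 v w c \<in> range (corner_map v w)" "Y2 w v c \<in> range (corner_map v w)"
    by (metis rangeI)+
  moreover have "v' = v \<and> w' = w \<or> v' = w \<and> w' = v" if "Y2 v' w' c = corner_map v w x" for x
    using that by (cases x) (auto simp: Y_eq split: if_splits)
  ultimately show ?thesis
    by blast
qed

lemma tessellated_surface_component_at:
  assumes vw: "indep v w"
  shows "tessellated_surface (component_at v w) (corner_map v w)"
proof
  let ?h = "corner_map v w"
  have comm: "comm v w \<noteq> 0"
    using assms by (auto simp: comm_def indep_def)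
  have "x = y" if "?h x = ?h y" for x y
    using that comm indep_irrefl[OF vw] by (cases x; cases y) (auto simp: Y_eq split: if_splits)
  then show "inj ?h"
    by (rule injI)
  show "vertices (component_at v w) = range ?h"
    by (simp add: component_at_def Let_def)
  show "edges (component_at v w) = {{?h (Corner True i), ?h (Corner False j)} | i j. True} \<union>
          {{?h (Corner s i), ?h (Centre k)} | s i k. True}" (is "_ = ?R")
  proof (intro equalityI subsetI)
    fix e assume "e \<in> edges (component_at v w)"
    then have e: "e \<in> edges (Y G)" "e \<subseteq> range ?h"
      by (auto simp: component_at_def Let_def)
    from e(1) consider v' w' c d where "e = {Y1 v' w' c, Y1 w' v' d}" | v' w' c d where "e = {Y1 v' w' c, Y2 v' w' d}"
      unfolding edges_Y by blast
    then show "e \<in> ?R"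
    proof cases
      case (1 v' w' c d)
      then have "v' = v \<and> w' = w \<or> v' = w \<and> w' = v"
        using e(2) Y1_in_range[OF vw, of v' w' c] by simp
      then obtain c d where "e = {Y1 v w c, Y1 w v d}"
        using 1 insert_commute by blast
      moreover obtain i j where "c = comm v w * i" "d = comm v w * j"
        using corner_map_surj[OF vw] by metis
      ultimately have "e = {?h (Corner True i), ?h (Corner False j)}"
        by simp
      then show ?thesis
        by blast
    next
      case (2 v' w' c d)
      obtain i k where "c = comm v w * i" "d = comm v w * k + \<beta> v w"
        using corner_map_surj[OF vw] by metis
      moreover have "v' = v \<and> w' = w \<or> v' = w \<and> w' = v"
        using e(2) Y1_in_range[OF vw, of v' w' c] unfolding 2 by simp
      \<comment> \<open>As v and w differ, \<open>v' = v\<close> tells whether the pair is in the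
        original or the reversed order, which is the side of the corner.\<close>
      ultimately have "e = {?h (Corner (v' = v) i), ?h (Centre k)}"
        using 2 indep_irrefl[OF vw] Y2_commute[of w v] by auto
      then show ?thesis
        by blast
    qed
  next
    fix e assume e: "e \<in> ?R"
    then have "e \<subseteq> range ?h"
      by blast
    moreover have "e \<in> edges (Y G)"
    proof -
      have wv: "indep w v"
        using vw indep_commute by blast
      have "{Y1 v w c, Y1 w v d} \<in> edges (Y G)" "{Y1 v w c, Y2 v w d} \<in> edges (Y G)"
         "{Y1 w v c, Y2 w v d} \<in> edges (Y G)" for c d
        unfolding edges_Y using vw wv by blast+
      with e show ?thesis
        using Y2_commute[of w v] by auto
    qed
    ultimately show "e \<in> edges (component_at v w)"
      by (simp add: component_at_def Let_def)
  qed
  show "triangles (component_at v w) = {(?h (Corner True i), ?h (Corner False j), ?h (Centre (i + j))) | i j. True} \<union>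
          {(?h (Corner False j), ?h (Corner True i), ?h (Centre (i + j + 1))) | i j. True}" (is "_ = ?R")
  proof -
    have eq1: "comm v w * i + comm v w * j + \<beta> v w = comm v w * (i + j) + \<beta> v w"
      and eq2: "comm v w * j + comm v w * i + \<beta> w v = comm v w * (i + j + 1) + \<beta> v w" for i j
      by (simp_all add: comm_def algebra_simps)
    show ?thesis
    proof (intro equalityI subsetI)
      fix t assume "t \<in> triangles (component_at v w)"
      then have t: "t \<in> triangles (Y G)" "tri_set t \<subseteq> range ?h"
        by (auto simp: component_at_def Let_def)
      from t(1) obtain v' w' c d where t': "t = (Y1 v' w' c, Y1 w' v' d, Y2 v' w' (c + d + \<beta> v' w'))"
        unfolding triangles_Y by blast
      then have "v' = v \<and> w' = w \<or> v' = w \<and> w' = v"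
        using t(2) Y1_in_range[OF vw, of v' w' c] by simp
      moreover obtain i j where ij: "c = comm v w * i" "d = comm v w * j"
        using corner_map_surj[OF vw] by metis
      ultimately consider "t = (?h (Corner True i), ?h (Corner False j), ?h (Centre (i + j)))"
        | "t = (?h (Corner False i), ?h (Corner True j), ?h (Centre (j + i + 1)))"
        using t' Y2_commute[of w v] eq1[of i j] eq2[of i j] by (auto simp: eq2[of i j] add.commute)
      then show "t \<in> ?R"
        by cases blast+
    next
      fix t assume t: "t \<in> ?R"
      then obtain i j where "t = (?h (Corner True i), ?h (Corner False j), ?h (Centre (i + j))) \<or>
          t = (?h (Corner False j), ?h (Corner True i), ?h (Centre (i + j + 1)))"
        by blast
      then have "tri_set t \<subseteq> range ?h"
        by (elim disjE) (simp_all only: tri_set.simps insert_subset rangeI empty_subsetI simp_thms)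
      moreover have "t \<in> triangles (Y G)"
      proof -
        have wv: "indep w v"
          using vw indep_commute by blast
        have "(Y1 v w c, Y1 w v d, Y2 v w (c + d + \<beta> v w)) \<in> triangles (Y G)"
           "(Y1 w v c, Y1 v w d, Y2 w v (c + d + \<beta> w v)) \<in> triangles (Y G)" for c d
          unfolding triangles_Y using vw wv by blast+
        note this[of "comm v w * i" "comm v w * j" for i j, unfolded eq1 eq2]
        with t show ?thesis
          using Y2_commute[of w v] by (auto simp: eq1[symmetric] eq2[symmetric])
      qed
      ultimately show "t \<in> triangles (component_at v w)"
        by (simp add: component_at_def Let_def)
    qed
  qed
  show "vertex_type (?h (Corner s i)) = 1" "vertex_type (?h (Centre k)) = 2" for s i k
    by (simp_all add: vertex_type_def Y1_def Y2_def X1_def X2_def)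
qed

text \<open>No edge leaves the vertices over an unordered pair of vectors, and the tripartite
  surface over that pair is connected.\<close>

lemma graph_component_Y:
  assumes vw: "indep v w" and x: "x \<in> range (corner_map v w)"
  shows "graph_component (edges (Y G)) x = range (corner_map v w)"
proof
  interpret tessellated_surface "component_at v w" "corner_map v w"
    using vw by (rule tessellated_surface_component_at)
  show "graph_component (edges (Y G)) x \<subseteq> range (corner_map v w)"
  proof (rule graph_component_closed)
    fix a b assume a: "a \<in> range (corner_map v w)" and ab: "{a, b} \<in> edges (Y G)"
    from ab consider v' w' c d where "{a, b} = {Y1 v' w' c, Y1 w' v' d}"
      | v' w' c d where "{a, b} = {Y1 v' w' c, Y2 v' w' d}"
      unfolding edges_Y by blast
    then show "b \<in> range (corner_map v w)"
    proof cases
      case (1 v' w' c d)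
      then consider "a = Y1 v' w' c" "b = Y1 w' v' d" | "b = Y1 v' w' c" "a = Y1 w' v' d"
        by (auto simp: doubleton_eq_iff)
      then show ?thesis
        using a by cases (auto simp only: Y1_in_range[OF vw])
    next
      case (2 v' w' c d)
      then consider "a = Y1 v' w' c" "b = Y2 v' w' d" | "b = Y1 v' w' c" "a = Y2 v' w' d"
        by (auto simp: doubleton_eq_iff)
      then show ?thesis
        using a by cases (auto simp only: Y1_in_range[OF vw] Y2_in_range[OF vw])
    qed
  qed (rule x)
  have "edges (component_at v w) \<subseteq> edges (Y G)"
    by (auto simp: component_at_def Let_def)
  then have "graph_component (edges (component_at v w)) x \<subseteq> graph_component (edges (Y G)) x"
    by (rule graph_component_mono)
  moreover have "y \<in> graph_component (edges (component_at v w)) x" if "y \<in> range (corner_map v w)" for y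
    by (rule connected) (use x that in \<open>simp_all add: vertices\<close>)
  ultimately show "range (corner_map v w) \<subseteq> graph_component (edges (Y G)) x"
    by (meson subset_iff)
qed

lemma components_Y: "components (Y G) = (\<lambda>(v, w). component_at v w) ` {(v, w). indep v w}"
proof -
  have "graph_component (edges (Y G)) ` vertices (Y G) = (\<lambda>(v, w). range (corner_map v w)) ` {(v, w). indep v w}"
  proof (intro equalityI subsetI)
    fix C assume "C \<in> graph_component (edges (Y G)) ` vertices (Y G)"
    then obtain x where x: "x \<in> vertices (Y G)" and C: "C = graph_component (edges (Y G)) x"
      by blast
    from x consider v w c where "x = Y1 v w c" "indep v w" | v w c where "x = Y2 v w c" "indep v w"
      unfolding vertices_Y by blast
    then obtain v w where vw: "indep v w" "x \<in> range (corner_map v w)"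
    proof cases
      case (1 v w c)
      then show ?thesis
        using that[of v w] Y1_in_range[of v w v w c] by simp
    next
      case (2 v w c)
      then show ?thesis
        using that[of v w] Y2_in_range[of v w v w c] by simp
    qed
    then show "C \<in> (\<lambda>(v, w). range (corner_map v w)) ` {(v, w). indep v w}"
      unfolding C using graph_component_Y by (intro image_eqI[of _ _ "(v, w)"]) auto
  next
    fix C assume "C \<in> (\<lambda>(v, w). range (corner_map v w)) ` {(v, w). indep v w}"
    then obtain v w where vw: "indep v w" and C: "C = range (corner_map v w)"
      by blast
    have "Y1 v w 0 \<in> range (corner_map v w)"
      using Y1_in_range[OF vw, of v w] by simp
    then have "C = graph_component (edges (Y G)) (Y1 v w 0)"
      unfolding C using graph_component_Y[OF vw] by simp
    moreover have "Y1 v w 0 \<in> vertices (Y G)"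
      unfolding vertices_Y using vw by blast
    ultimately show "C \<in> graph_component (edges (Y G)) ` vertices (Y G)"
      by blast
  qed
  then show ?thesis
    unfolding components_def by (simp add: image_image case_prod_unfold component_at_def Let_def)
qed

section \<open>Counting the components\<close>

lemma component_at_eq_iff:
  assumes "indep v w" "indep v' w'"
  shows "component_at v w = component_at v' w' \<longleftrightarrow> v' = v \<and> w' = w \<or> v' = w \<and> w' = v"
proof
  assume "component_at v w = component_at v' w'"
  then have "range (corner_map v w) = range (corner_map v' w')"
    by (simp add: component_at_def Let_def)
  moreover have "Y1 v' w' 0 \<in> range (corner_map v' w')"
    using Y1_in_range[OF assms(2), of v' w'] by simp
  ultimately show "v' = v \<and> w' = w \<or> v' = w \<and> w' = v"
    using Y1_in_range[OF assms(1), of v' w' 0] by simp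
next
  \<comment> \<open>Both parametrizations run through the graph component of this one vertex, so
    their ranges agree.\<close>
  have "Y1 v w 0 \<in> range (corner_map v w)" "Y1 v w 0 \<in> range (corner_map w v)"
    using Y1_in_range[of _ _ v w] assms(1) indep_commute[of v w] by simp_all
  moreover have "indep w v"
    using assms(1) indep_commute by blast
  ultimately have "range (corner_map v w) = range (corner_map w v)"
    using graph_component_Y[OF assms(1)] graph_component_Y[of w v] by (metis (no_types))
  then have "component_at w v = component_at v w"
    by (simp add: component_at_def)
  moreover assume "v' = v \<and> w' = w \<or> v' = w \<and> w' = v"
  ultimately show "component_at v w = component_at v' w'"
    by auto
qed

text \<open>Each component arises from exactly two ordered pairs, (v, w) and (w, v), which are
  distinct since v and w are.\<close>

lemma card_components_Y:
  assumes "finite {(v, w). indep v w}"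
  shows "2 * card (components (Y G)) = card {(v, w). indep v w}"
proof -
  let ?S = "{(v, w). indep v w}" and ?f = "\<lambda>(v, w). component_at v w"
  have "card ?S = (\<Sum>K\<in>?f ` ?S. card {x \<in> ?S. ?f x = K})"
    unfolding card_eq_sum by (rule sum.image_gen[OF assms])
  also have "\<dots> = (\<Sum>K\<in>?f ` ?S. 2)"
  proof (rule sum.cong)
    fix K assume "K \<in> ?f ` ?S"
    then obtain v w where vw: "indep v w" and K: "K = component_at v w"
      by auto
    have "indep v' w' \<and> component_at v' w' = K \<longleftrightarrow> v' = v \<and> w' = w \<or> v' = w \<and> w' = v" for v' w'
      using component_at_eq_iff[OF _ vw, of v' w'] vw indep_commute[of v w] unfolding K by blast
    then have "{x \<in> ?S. ?f x = K} = {(v, w), (w, v)}"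
      by auto
    then show "card {x \<in> ?S. ?f x = K} = 2"
      using indep_irrefl[OF vw] by simp
  qed simp
  finally show ?thesis
    unfolding components_Y by simp
qed

end

subsection \<open>Unitriangular matrices\<close>

text \<open>\<open>v\<close> collects the superdiagonal entries, which survive modulo the center,
  and \<open>c\<close> is the central coordinate in the upper right corner.\<close>

definition unitriangular :: "'a::semiring_1 \<times> 'a \<Rightarrow> 'a \<Rightarrow> 'a mat" where
  "unitriangular v c = mat 3 3 (\<lambda>(i, j). if i = j then 1 else if (i, j) = (0, 1) then fst v
     else if (i, j) = (1, 2) then snd v else if (i, j) = (0, 2) then c else 0)"

lemma less_3_cases: "(i::nat) < 3 \<longleftrightarrow> i = 0 \<or> i = 1 \<or> i = 2"
  by auto

lemma carrier_U3: "carrier U3 = {unitriangular v c | v c. True}"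
proof (intro equalityI subsetI)
  fix A :: "'p::prime_card mod_ring mat"
  assume "A \<in> carrier U3"
  then have A: "A \<in> carrier_mat 3 3" "upper_triangular A" "\<forall>i<3. A $$ (i, i) = 1"
    by (auto simp: U3_def)
  have "A $$ (1, 0) = 0" "A $$ (2, 0) = 0" "A $$ (2, 1) = 0"
    using A(1) by (auto intro!: upper_triangularD[OF A(2)])
  moreover have "A $$ (0, 0) = 1" "A $$ (1, 1) = 1" "A $$ (2, 2) = 1"
    using A(3) by simp_all
  ultimately have "A = unitriangular (A $$ (0, 1), A $$ (1, 2)) (A $$ (0, 2))"
    using A(1) by (intro eq_matI) (auto simp: unitriangular_def less_3_cases)
  then show "A \<in> {unitriangular v c | v c. True}"
    by blast
qed (auto simp: U3_def unitriangular_def less_3_cases upper_triangular_def less_2_cases_iff)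

lemma unitriangular_mult:
  "unitriangular v c * unitriangular w d = unitriangular (v + w) (c + d + fst v * snd w)"
  for c :: "'a::comm_ring_1"
  by (rule eq_matI)
     (auto simp: unitriangular_def scalar_prod_def less_3_cases numeral_3_eq_3 sum.atLeast0_lessThan_Suc)

lemma unitriangular_eq_iff: "unitriangular v c = unitriangular w d \<longleftrightarrow> v = w \<and> c = d"
proof
  assume eq: "unitriangular v c = unitriangular w d"
  have "unitriangular v c $$ (0, 1) = fst v" "unitriangular v c $$ (1, 2) = snd v" "unitriangular v c $$ (0, 2) = c"
    for v and c :: 'a
    by (simp_all add: unitriangular_def)
  then show "v = w \<and> c = d"
    using eq by (metis prod.expand)
qed simp

interpretation U3: central_extension U3 unitriangular "\<lambda>v w :: 'p::prime_card mod_ring \<times> 'p mod_ring. fst v * snd w"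
proof
  show "carrier U3 = {unitriangular v c | v (c :: 'p mod_ring). True}"
    by (rule carrier_U3)
  show "unitriangular v c = unitriangular w d \<longleftrightarrow> v = w \<and> c = d"
    for v w :: "'p mod_ring \<times> 'p mod_ring" and c d
    by (rule unitriangular_eq_iff)
  show "unitriangular v c \<otimes>\<^bsub>U3\<^esub> unitriangular w d = unitriangular (v + w) (c + d + fst v * snd w)"
    for v w :: "'p mod_ring \<times> 'p mod_ring" and c d
    by (simp add: U3_def unitriangular_mult)
qed (simp_all add: algebra_simps)

text \<open>The number of ordered bases of the plane: any nonzero first vector, then any vector
  outside the p multiples of the first.\<close>

lemma card_indep:
  "card {(v :: 'p::prime_card mod_ring \<times> 'p mod_ring, w). U3.indep v w} =
    (CARD('p) ^ 2 - 1) * (CARD('p) ^ 2 - CARD('p))"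
proof -
  have dep: "card {w. \<not> U3.indep v w} = CARD('p)" if "v \<noteq> 0" for v :: "'p mod_ring \<times> 'p mod_ring"
  proof -
    let ?f = "\<lambda>t. (t * fst v, t * snd v)"
    have v: "fst v \<noteq> 0 \<or> snd v \<noteq> 0"
      using that by (metis prod.collapse zero_prod_def)
    have "w \<in> range ?f" if "fst v * snd w = fst w * snd v" for w
    proof (cases "fst v = 0")
      case True
      then show ?thesis
        using v that by (intro image_eqI[of _ _ "snd w / snd v"]) (auto simp: prod_eq_iff)
    next
      case False
      then show ?thesis
        using that by (intro image_eqI[of _ _ "fst w / fst v"]) (auto simp: prod_eq_iff field_simps)
    qed
    then have "{w. \<not> U3.indep v w} = range ?f"
      by (auto simp: U3.indep_def)
    moreover have "inj ?f"
      using v by (auto intro!: injI)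
    ultimately show ?thesis
      by (simp add: card_image)
  qed
  have "card {w. U3.indep v w} = CARD('p) ^ 2 - CARD('p)" if "v \<noteq> 0" for v :: "'p mod_ring \<times> 'p mod_ring"
  proof -
    have "{w. U3.indep v w} = UNIV - {w. \<not> U3.indep v w}"
      by auto
    then show ?thesis
      using dep[OF that] by (simp add: card_Diff_subset power2_eq_square)
  qed
  moreover have "{(v :: 'p mod_ring \<times> 'p mod_ring, w). U3.indep v w} = Sigma (UNIV - {0}) (\<lambda>v. {w. U3.indep v w})"
    by (auto simp: U3.indep_def)
  ultimately show ?thesis
    by (simp add: card_Diff_subset power2_eq_square)
qed

section \<open>The three claims for U_3(p)\<close>

theorem theorem3p4:
  fixes p :: nat and G :: "'p::prime_card mod_ring mat monoid"
  assumes "prime p" and "odd p" and "CARD('p) = p" and "G = U3"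
  shows
    "((\<forall>K \<in> components (Y G). \<forall>L \<in> components (Y G). cell_isomorphic K L) \<and>
      card (components (Y G)) = ((p\<^sup>2 - 1) * (p\<^sup>2 - p)) div 2) \<and>
     (\<forall>K \<in> components (Y G).
        regular_polytope 3 (hat_poset K) \<and> has_schlafli_symbol (hat_poset K) (2 * p) p) \<and>
     (\<forall>K \<in> components (Y G).
        closed_oriented_surface_of_genus (p * (p - 3) div 2 + 1) K \<and>
        tessellates_with_ngons K (2 * p) \<and>
        card (hat_faces K) = p \<and> card (hat_edges K) = p\<^sup>2 \<and> card (hat_vertices K) = 2 * p \<and>
        (\<forall>v \<in> hat_vertices K. valency K v = p))"
proof -
  \<comment> \<open>Once each component is identified with the tripartite model, the remaining
    claims, apart from the number of components, are properties of the model.\<close>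
  have model: "\<exists>h :: 'p mod_ring corner \<Rightarrow> _. tessellated_surface K h" if K: "K \<in> components (Y G)" for K
  proof -
    obtain v w :: "'p mod_ring \<times> 'p mod_ring" where "U3.indep v w" "K = U3.component_at v w"
      using K unfolding \<open>G = U3\<close> U3.components_Y by auto
    then show ?thesis
      using U3.tessellated_surface_component_at by blast
  qed
  have "cell_isomorphic K L" if "K \<in> components (Y G)" "L \<in> components (Y G)" for K L
    using model[OF that(1)] model[OF that(2)] cell_isomorphic_models by blast
  moreover have "card (components (Y G)) = ((p\<^sup>2 - 1) * (p\<^sup>2 - p)) div 2"
  proof -
    have "2 * card (components (Y G)) = card {(v :: 'p mod_ring \<times> 'p mod_ring, w). U3.indep v w}"
      unfolding \<open>G = U3\<close> by (rule U3.card_components_Y) simp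
    also have "\<dots> = (p\<^sup>2 - 1) * (p\<^sup>2 - p)"
      unfolding card_indep \<open>CARD('p) = p\<close> ..
    finally show ?thesis
      by linarith
  qed
  moreover have "regular_polytope 3 (hat_poset K) \<and> has_schlafli_symbol (hat_poset K) (2 * p) p \<and>
      closed_oriented_surface_of_genus (p * (p - 3) div 2 + 1) K \<and> tessellates_with_ngons K (2 * p) \<and>
      card (hat_faces K) = p \<and> card (hat_edges K) = p\<^sup>2 \<and> card (hat_vertices K) = 2 * p \<and>
      (\<forall>v \<in> hat_vertices K. valency K v = p)" if K: "K \<in> components (Y G)" for K
  proof -
    obtain h :: "'p mod_ring corner \<Rightarrow> _" where "tessellated_surface K h"
      using model[OF K] by blast
    then interpret tessellated_surface K h .
    show ?thesis
      using poset.regular_polytope poset.has_schlafli_symbol closed_oriented_surface_of_genus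
        tessellates_with_ngons card_hat_faces card_hat_edges card_hat_vertices valency
      unfolding \<open>CARD('p) = p\<close> using \<open>odd p\<close> by blast
  qed
  ultimately show ?thesis
    by blast
qed

end
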